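(* There is a polynomial-time algorithm that, given a reducible flow graph $(G,s)$ with $G=(V,E)$ a simple directed graph, computes an LR-order of $G$. In particular, every reducible flow graph admits an LR-order.
   Context: Flow graphs and depth-first spanning trees: - A flow graph $(G,s)$ is a directed graph $G$ with a vertex $s$ such that every vertex of $V\setminus\{s\}$ is reachable by a directed path from $s$. - A depth-first search from $s$ yields a depth-first spanning tree (DFST) $T$ rooted at $s$, together with a preorder numbering $po()$, where $po(v)>po(w)$ iff $v$ is visited after $w$. - Write $v\xrightarrow{*}w$ if $T$ contains a directed path from $v$ to $w$. With respect to $T$, an arc $vw$ of $G$ is: - a tree arc if $vw\in E(T)$; - a forward arc if $vw\notin E(T)$ and $v\xrightarrow{*}w$; - a cycle arc if $w\xrightarrow{*}v$; - a cross arc if neither $v\xrightarrow{*}w$ nor $w\xrightarrow{*}v$, and $po(w)<po(v)$. The flow graph $(G,s)$ is reducible if the subgraph formed by its tree, forward and cross arcs has the same arc set for every DFST $T$ rooted at $s$. An LR-order of $G$ is a linear order $\prec$ on $V$ such that, for every vertex $v$, the successors of $v$ are either all before $v$ or all after $v$ in $\prec$. *)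

theory Defs
  imports
    "Graph_Theory.Pair_Digraph"
    "HOL-Computational_Algebra.Polynomial"
    "HOL-Library.Discrete_Functions"
begin

section \<open>Flow graphs, depth-first search and reducibility\<close>

text \<open>Graphs are arc sets of ordered pairs; the locale \<^locale>\<open>pair_digraph\<close> says that
  such a graph is finite and loop-free (parallel arcs are impossible), i.e. a finite simple
  digraph. Pairs of opposite arcs are allowed.\<close>

definition flow_graph :: "'a pair_pre_digraph \<Rightarrow> 'a \<Rightarrow> bool" where
  "flow_graph G s \<longleftrightarrow>
     s \<in> pverts G \<and> (\<forall>v \<in> pverts G - {s}. s \<rightarrow>\<^sup>*\<^bsub>with_proj G\<^esub> v)"

text \<open>The configurations of a (nondeterministic) depth-first search from \<open>s\<close>: the stack with
  its top first, the visited vertices in the order of their first visit, and the tree arcs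
  found so far. The search may proceed to any unvisited successor of the top vertex, and
  leaves that vertex only when all its successors have been visited.\<close>

inductive dfs_config ::
  "'a pair_pre_digraph \<Rightarrow> 'a \<Rightarrow> 'a list \<Rightarrow> 'a list \<Rightarrow> 'a rel \<Rightarrow> bool" for G s where
  start: "dfs_config G s [s] [s] {}"
| advance: "\<lbrakk>dfs_config G s (v # st) xs T; (v, w) \<in> parcs G; w \<notin> set xs\<rbrakk>
     \<Longrightarrow> dfs_config G s (w # v # st) (xs @ [w]) (insert (v, w) T)"
| retreat: "\<lbrakk>dfs_config G s (v # st) xs T; \<forall>w. (v, w) \<in> parcs G \<longrightarrow> w \<in> set xs\<rbrakk>
     \<Longrightarrow> dfs_config G s st xs T"

text \<open>A spanning tree \<open>T\<close> together with the preorder \<open>xs\<close> produced by a completed search.\<close>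

definition dfst :: "'a pair_pre_digraph \<Rightarrow> 'a \<Rightarrow> 'a list \<Rightarrow> 'a rel \<Rightarrow> bool" where
  "dfst G s xs T \<longleftrightarrow> dfs_config G s [] xs T"

definition preorder_number :: "'a list \<Rightarrow> 'a \<Rightarrow> nat" where
  "preorder_number xs v = length (takeWhile (\<lambda>u. u \<noteq> v) xs)"

definition tree_path :: "'a rel \<Rightarrow> 'a \<Rightarrow> 'a \<Rightarrow> bool" where
  "tree_path T v w \<longleftrightarrow> (v, w) \<in> T\<^sup>*"

definition tree_arcs :: "'a pair_pre_digraph \<Rightarrow> 'a rel \<Rightarrow> 'a rel" where
  "tree_arcs G T = {(v, w) \<in> parcs G. (v, w) \<in> T}"

definition forward_arcs :: "'a pair_pre_digraph \<Rightarrow> 'a rel \<Rightarrow> 'a rel" where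
  "forward_arcs G T = {(v, w) \<in> parcs G. (v, w) \<notin> T \<and> tree_path T v w}"

definition cycle_arcs :: "'a pair_pre_digraph \<Rightarrow> 'a rel \<Rightarrow> 'a rel" where
  "cycle_arcs G T = {(v, w) \<in> parcs G. tree_path T w v}"

definition cross_arcs :: "'a pair_pre_digraph \<Rightarrow> 'a list \<Rightarrow> 'a rel \<Rightarrow> 'a rel" where
  "cross_arcs G xs T = {(v, w) \<in> parcs G. \<not> tree_path T v w \<and> \<not> tree_path T w v \<and>
     preorder_number xs w < preorder_number xs v}"

definition acyclic_part :: "'a pair_pre_digraph \<Rightarrow> 'a list \<Rightarrow> 'a rel \<Rightarrow> 'a rel" where
  "acyclic_part G xs T = tree_arcs G T \<union> forward_arcs G T \<union> cross_arcs G xs T"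

definition reducible_flow_graph :: "'a pair_pre_digraph \<Rightarrow> 'a \<Rightarrow> bool" where
  "reducible_flow_graph G s \<longleftrightarrow> flow_graph G s \<and>
     (\<forall>xs T xs' T'. dfst G s xs T \<longrightarrow> dfst G s xs' T' \<longrightarrow>
        acyclic_part G xs T = acyclic_part G xs' T')"


section \<open>LR-orders\<close>

text \<open>\<open>(x, y) \<in> r\<close> is read as \<open>x \<prec> y\<close>.\<close>

definition lr_order :: "'a pair_pre_digraph \<Rightarrow> 'a rel \<Rightarrow> bool" where
  "lr_order G r \<longleftrightarrow> r \<subseteq> pverts G \<times> pverts G \<and> strict_linear_order_on (pverts G) r \<and>
     (\<forall>v \<in> pverts G. (\<forall>w. (v, w) \<in> parcs G \<longrightarrow> (w, v) \<in> r) \<or>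
                     (\<forall>w. (v, w) \<in> parcs G \<longrightarrow> (v, w) \<in> r))"

definition list_order :: "'a list \<Rightarrow> 'a rel" where
  "list_order ys = {(ys ! i, ys ! j) | i j. i < j \<and> j < length ys}"


section \<open>Polynomial-time algorithms\<close>

text \<open>The machine model is a random access machine whose memory consists of the named arrays
  (unbounded sequences of natural numbers) and whose programs are while-programs. Every node
  of an evaluated expression and every executed command costs one unit. The only arithmetic
  operations are addition and truncated subtraction, so the bit length of the numbers
  computed is bounded by the elapsed time plus the bit length of the input numbers and of the
  constants in the program. Polynomial time in this model is therefore the same as polynomial
  time on Turing machines. A program is fixed before its input, and mentions only finitely many
  arrays.\<close>

type_synonym memory = "string \<Rightarrow> nat \<Rightarrow> nat"

datatype aexp = Const nat | Read string aexp | Add aexp aexp | Sub aexp aexp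

datatype bexp = Less aexp aexp | Equal aexp aexp | Neg bexp | Conj bexp bexp

datatype com =
    Skip
  | Assign string aexp aexp
  | Seq com com
  | Cond bexp com com
  | While bexp com

fun aval :: "aexp \<Rightarrow> memory \<Rightarrow> nat" where
  "aval (Const n) m = n"
| "aval (Read a e) m = m a (aval e m)"
| "aval (Add e f) m = aval e m + aval f m"
| "aval (Sub e f) m = aval e m - aval f m"

fun bval :: "bexp \<Rightarrow> memory \<Rightarrow> bool" where
  "bval (Less e f) m \<longleftrightarrow> aval e m < aval f m"
| "bval (Equal e f) m \<longleftrightarrow> aval e m = aval f m"
| "bval (Neg b) m \<longleftrightarrow> \<not> bval b m"
| "bval (Conj b c) m \<longleftrightarrow> bval b m \<and> bval c m"

fun acost :: "aexp \<Rightarrow> nat" where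
  "acost (Const n) = 1"
| "acost (Read a e) = 1 + acost e"
| "acost (Add e f) = 1 + acost e + acost f"
| "acost (Sub e f) = 1 + acost e + acost f"

fun bcost :: "bexp \<Rightarrow> nat" where
  "bcost (Less e f) = 1 + acost e + acost f"
| "bcost (Equal e f) = 1 + acost e + acost f"
| "bcost (Neg b) = 1 + bcost b"
| "bcost (Conj b c) = 1 + bcost b + bcost c"

text \<open>\<open>exec c m t m'\<close>: started in memory \<open>m\<close>, the program \<open>c\<close> halts in memory \<open>m'\<close> after time
  \<open>t\<close>. \<open>Assign a i e\<close> writes the value of \<open>e\<close> into cell \<open>i\<close> of the array \<open>a\<close>.\<close>

inductive exec :: "com \<Rightarrow> memory \<Rightarrow> nat \<Rightarrow> memory \<Rightarrow> bool" where
  Skip: "exec Skip m 1 m"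
| Assign: "exec (Assign a i e) m (1 + acost i + acost e)
     (m(a := (m a)(aval i m := aval e m)))"
| Seq: "\<lbrakk>exec c m t m'; exec d m' u m''\<rbrakk> \<Longrightarrow> exec (Seq c d) m (1 + t + u) m''"
| CondTrue: "\<lbrakk>bval b m; exec c m t m'\<rbrakk> \<Longrightarrow> exec (Cond b c d) m (1 + bcost b + t) m'"
| CondFalse: "\<lbrakk>\<not> bval b m; exec d m t m'\<rbrakk> \<Longrightarrow> exec (Cond b c d) m (1 + bcost b + t) m'"
| WhileFalse: "\<not> bval b m \<Longrightarrow> exec (While b c) m (1 + bcost b) m"
| WhileTrue: "\<lbrakk>bval b m; exec c m t m'; exec (While b c) m' u m''\<rbrakk>
     \<Longrightarrow> exec (While b c) m (1 + bcost b + t + u) m''"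

lemma exec_deterministic:
  "exec c m t m' \<Longrightarrow> exec c m u m'' \<Longrightarrow> u = t \<and> m'' = m'"
proof (induction arbitrary: u m'' rule: exec.induct)
  case (Skip m)
  then show ?case by (auto elim: exec.cases)
next
  case (Assign a i e m)
  then show ?case by (auto elim: exec.cases)
next
  case (Seq c m t m' d u m'' v n)
  from Seq.prems show ?case by (cases rule: exec.cases) (use Seq.IH in blast)
next
  case (CondTrue b m c t m' d)
  from CondTrue.prems show ?case
    by (cases rule: exec.cases) (use CondTrue.IH CondTrue.hyps in blast)+
next
  case (CondFalse b m d t m' c)
  from CondFalse.prems show ?case
    by (cases rule: exec.cases) (use CondFalse.IH CondFalse.hyps in blast)+
next
  case (WhileFalse b m c)
  from WhileFalse.prems show ?case
    by (cases rule: exec.cases) (use WhileFalse.hyps in blast)+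
next
  case (WhileTrue b m c t m' u m'' v n)
  from WhileTrue.prems show ?case
    by (cases rule: exec.cases) (use WhileTrue.IH WhileTrue.hyps in blast)+
qed

text \<open>Lists are stored with their length in cell 0 and their elements in the cells from 1 on.
  All other cells are initially 0.\<close>

definition input_memory :: "nat list \<Rightarrow> memory" where
  "input_memory xs = (\<lambda>a i. if a \<noteq> ''input'' then 0
     else if i = 0 then length xs
     else if i \<le> length xs then xs ! (i - 1)
     else 0)"

definition output_list :: "memory \<Rightarrow> nat list" where
  "output_list m = map (\<lambda>i. m ''output'' (Suc i)) [0..<m ''output'' 0]"

text \<open>The total number of bits of the input.\<close>

definition input_size :: "nat list \<Rightarrow> nat" where
  "input_size xs = (\<Sum>x\<leftarrow>xs. floor_log x + 1)"

text \<open>The search problem with instance set \<open>I\<close>, in which \<open>code x xs\<close> says that the list \<open>xs\<close> is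
  an encoding of the instance \<open>x\<close>, and \<open>sol x ys\<close> that \<open>ys\<close> is a correct answer to \<open>x\<close>. One
  program and one polynomial have to serve all instances and all their encodings.\<close>

definition solvable_in_poly_time ::
  "'i set \<Rightarrow> ('i \<Rightarrow> nat list \<Rightarrow> bool) \<Rightarrow> ('i \<Rightarrow> nat list \<Rightarrow> bool) \<Rightarrow> bool" where
  "solvable_in_poly_time I code sol \<longleftrightarrow>
     (\<exists>(c :: com) (p :: nat poly). \<forall>x \<in> I. \<forall>xs. code x xs \<longrightarrow>
        (\<exists>t m. exec c (input_memory xs) t m \<and> t \<le> poly p (input_size xs) \<and>
               sol x (output_list m)))"

text \<open>A rooted graph on the vertices \<open>0, \<dots>, n - 1\<close> is encoded by \<open>n\<close>, the root, and a list of
  its arcs without repetitions, in any order.\<close>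

definition encodes_rooted_graph :: "nat pair_pre_digraph \<times> nat \<Rightarrow> nat list \<Rightarrow> bool" where
  "encodes_rooted_graph = (\<lambda>(G, s) xs. \<exists>n es. pverts G = {..<n} \<and>
     distinct es \<and> set es = parcs G \<and> xs = n # s # concat (map (\<lambda>(v, w). [v, w]) es))"

definition lists_lr_order :: "nat pair_pre_digraph \<times> nat \<Rightarrow> nat list \<Rightarrow> bool" where
  "lists_lr_order = (\<lambda>(G, s) ys. distinct ys \<and> set ys = pverts G \<and> lr_order G (list_order ys))"

end

theory Submission
  imports Defs
begin

text \<open>If the vertices are split into two classes each of which induces an acyclic subgraph, then
  a topological order of the first class followed by a reversed topological order of the second
  is an LR-order. In a reducible flow graph the parity of the breadth-first layer is such a
  splitting. Indeed, let a path start at \<open>s\<close> and end in \<open>u\<close>, and let \<open>uh\<close> be an arc back to a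
  vertex \<open>h\<close> of the path. Then \<open>uh\<close> is a cycle arc for a search that follows the path. If some
  path from \<open>s\<close> to \<open>u\<close> avoided \<open>h\<close>, then \<open>uh\<close> would be a tree arc for a search following that
  one, against reducibility. Hence every path from \<open>s\<close> to \<open>u\<close> passes through \<open>h\<close>, and so does
  every path from \<open>s\<close> to the successor \<open>x\<close> of \<open>h\<close> on the first path. So \<open>x\<close> is exactly one
  layer below \<open>h\<close>, and the cycle through \<open>h\<close> and \<open>x\<close> meets both classes.\<close>

section \<open>Depth-first search along a path\<close>

text \<open>A new tree arc leads to an unvisited vertex, which no earlier tree arc touches, so it
  cannot close a cycle. Acyclicity later excludes tree paths in both directions between two distinct
  vertices.\<close>

lemma dfs_config_tree:
  assumes "dfs_config G s st xs T"
  shows "set st \<subseteq> set xs \<and> T \<subseteq> set xs \<times> set xs \<and> acyclic T"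
  using assms
proof induction
  case (advance v st xs T w)
  have "(w, v) \<notin> T\<^sup>*"
  proof
    assume "(w, v) \<in> T\<^sup>*"
    then show False
      using advance by (cases rule: converse_rtranclE) auto
  qed
  then show ?case
    using advance by (auto simp: acyclic_insert)
qed (auto simp: acyclic_def)

text \<open>Along a path with distinct vertices the top of the stack always has an unvisited
  successor, so the search can advance without ever retreating. \<open>zip (s # xs) xs\<close> lists
  the arcs of the path.\<close>

lemma dfs_config_along_path:
  assumes "distinct (s # xs)" "successively (\<lambda>u v. (u, v) \<in> parcs G) (s # xs)"
  shows "dfs_config G s (rev (s # xs)) (s # xs) (set (zip (s # xs) xs))"
  using assms
proof (induction xs rule: rev_induct)
  case Nil
  then show ?case by (simp add: dfs_config.start)
next
  case (snoc w xs)
  define v where "v = last (s # xs)"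
  have split: "rev (s # xs) = v # tl (rev (s # xs))"
    by (simp add: v_def flip: hd_rev)
  have *: "successively (\<lambda>u v. (u, v) \<in> parcs G) (s # xs)" and "(v, w) \<in> parcs G"
    using snoc.prems by (auto simp: v_def successively_append_iff simp flip: append_Cons)
  obtain ws where ws: "s # xs = ws @ [v]" "length ws = length xs"
    by (metis append_butlast_last_id v_def length_butlast list.distinct(1) diff_Suc_1 length_Cons)
  \<comment> \<open>\<open>zip\<close> drops the surplus last vertex \<open>v\<close> of
    \<open>s # xs\<close>; appending \<open>w\<close> to both lists gives \<open>v\<close> its
    partner.\<close>
  have zip: "set (zip (s # xs @ [w]) (xs @ [w])) = insert (v, w) (set (zip (s # xs) xs))"
    using ws by (auto simp flip: append_Cons simp: zip_append1 take_Cons' simp del: zip_Cons1)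
  have "dfs_config G s (v # tl (rev (s # xs))) (s # xs) (set (zip (s # xs) xs))"
    using snoc * split by (metis append_Cons distinct_append)
  from dfs_config.advance[OF this \<open>(v, w) \<in> parcs G\<close>] snoc.prems zip split
  show ?case by (auto simp del: zip_Cons1)
qed

lemma (in pair_digraph) dfs_config_completes:
  assumes "dfs_config G s st xs T" "set xs \<subseteq> pverts G"
  shows "\<exists>xs' T'. dfst G s xs' T' \<and> T \<subseteq> T'"
  using assms
\<comment> \<open>An advance lengthens the stack by one but removes an unvisited vertex, hence the
  weight 2; a retreat shortens the stack.\<close>
proof (induction "2 * card (pverts G - set xs) + length st" arbitrary: st xs T rule: less_induct)
  case less
  show ?case
  proof (cases st)
    case Nil
    then show ?thesis using less.prems by (auto simp: dfst_def)
  next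
    case (Cons v st')
    show ?thesis
    proof (cases "\<forall>w. (v, w) \<in> parcs G \<longrightarrow> w \<in> set xs")
      case True
      then have "dfs_config G s st' xs T"
        using less.prems Cons dfs_config.retreat by metis
      then show ?thesis
        using less.hyps[of xs st' T] less.prems(2) Cons by simp
    next
      case False
      then obtain w where w: "(v, w) \<in> parcs G" "w \<notin> set xs" by blast
      then have "w \<in> pverts G" by (auto dest: in_arcsD2)
      have "pverts G - set (xs @ [w]) \<subset> pverts G - set xs"
        using \<open>w \<in> pverts G\<close> w by auto
      then have "card (pverts G - set (xs @ [w])) < card (pverts G - set xs)"
        by (intro psubset_card_mono) auto
      moreover have "dfs_config G s (w # v # st') (xs @ [w]) (insert (v, w) T)"
        using less.prems Cons w dfs_config.advance by metis
      ultimately obtain xs' T' where "dfst G s xs' T'" "insert (v, w) T \<subseteq> T'"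
        using less.hyps[of "xs @ [w]" "w # v # st'" "insert (v, w) T"]
          less.prems(2) \<open>w \<in> pverts G\<close> Cons by auto
      then show ?thesis by blast
    qed
  qed
qed

lemma (in pair_digraph) dfst_along_path:
  assumes "s \<in> pverts G" "distinct (s # xs)"
    and "successively (\<lambda>u v. (u, v) \<in> parcs G) (s # xs)"
  shows "\<exists>xs' T'. dfst G s xs' T' \<and> set (zip (s # xs) xs) \<subseteq> T'"
proof (rule dfs_config_completes)
  show "dfs_config G s (rev (s # xs)) (s # xs) (set (zip (s # xs) xs))"
    using assms by (intro dfs_config_along_path)
  have "v \<in> pverts G" if "v \<in> set xs" for v
    using assms(3) that
  proof (induction xs rule: rev_induct)
    case (snoc w xs)
    then show ?case
      by (cases xs rule: rev_cases)
        (auto simp: successively_append_iff dest: in_arcsD2 simp flip: append_Cons)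
  qed simp
  then show "set (s # xs) \<subseteq> pverts G"
    using assms(1) by auto
qed

section \<open>Distinct paths and the heads of cycle arcs\<close>

lemma rtrancl_imp_distinct_path:
  assumes "(s, v) \<in> r\<^sup>*"
  shows "\<exists>xs. distinct (s # xs) \<and> successively (\<lambda>u v. (u, v) \<in> r) (s # xs) \<and> last (s # xs) = v"
  using assms
proof induction
  case base
  show ?case by (rule exI[of _ "[]"]) simp
next
  case (step v w)
  then obtain xs where xs: "distinct (s # xs)" "successively (\<lambda>u v. (u, v) \<in> r) (s # xs)"
    "last (s # xs) = v" by blast
  show ?case
  proof (cases "w \<in> set (s # xs)")
    \<comment> \<open>The walk has returned to \<open>w\<close>, so the path is cut off at the
      earlier occurrence.\<close>
    case True
    then obtain as bs where *: "s # xs = as @ w # bs" by (meson split_list)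
    show ?thesis
    proof (cases as)
      case Nil
      then show ?thesis using * by (intro exI[of _ "[]"]) simp
    next
      case (Cons a as')
      then have "s # xs = (s # as' @ [w]) @ bs" using * by simp
      then show ?thesis
        using xs by (intro exI[of _ "as' @ [w]"]) (metis distinct_append last_ConsR last_snoc
            snoc_eq_iff_butlast successively_append_iff)
    qed
  next
    case False
    then show ?thesis
      using xs step.hyps
      by (intro exI[of _ "xs @ [w]"]) (auto simp: successively_append_iff simp flip: append_Cons)
  qed
qed

lemma successively_nth_rtrancl:
  assumes "successively (\<lambda>u v. (u, v) \<in> r) xs" "i \<le> j" "j < length xs"
  shows "(xs ! i, xs ! j) \<in> r\<^sup>*"
  using assms(2,3)
proof (induction j rule: dec_induct)
  case (step k)
  have "(xs ! k, xs ! Suc k) \<in> r"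
    using assms(1) step.prems by (auto simp: successively_conv_nth)
  then show ?case using step by (auto intro: rtrancl_into_rtrancl)
qed simp

text \<open>This is one direction of the dominator characterisation of reducibility: the head of a
  cycle arc dominates its tail. Two searches, one along each path, are compared on the arc
  \<open>(u, h)\<close>.\<close>

lemma (in pair_digraph) cycle_arc_head_on_path:
  assumes red: "reducible_flow_graph G s"
    and xs: "distinct (s # xs)" "successively (\<lambda>u v. (u, v) \<in> parcs G) (s # xs)"
    and u: "last (s # xs) = u" and h: "h \<in> set (s # xs)" and uh: "(u, h) \<in> parcs G"
    and ys: "distinct (s # ys)" "successively (\<lambda>u v. (u, v) \<in> parcs G) (s # ys)"
      "last (s # ys) = u"
  shows "h \<in> set (s # ys)"
proof (rule ccontr)
  assume notin: "h \<notin> set (s # ys)"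
  have s: "s \<in> pverts G"
    using red by (simp add: reducible_flow_graph_def flow_graph_def)
  have "u \<noteq> h" using uh no_loops by force
  obtain zs T where T: "dfst G s zs T" "set (zip (s # xs) xs) \<subseteq> T"
    using dfst_along_path[OF s xs] by blast
  have acyc: "acyclic T"
    using T(1) dfs_config_tree[of G s "[]"] by (simp add: dfst_def)
  have "successively (\<lambda>u v. (u, v) \<in> T) (s # xs)"
    using T(2) by (auto simp: successively_conv_nth set_zip)
  moreover obtain j where "j < length (s # xs)" "(s # xs) ! j = h"
    using h by (metis in_set_conv_nth)
  ultimately have hu: "(h, u) \<in> T\<^sup>*"
    using successively_nth_rtrancl[of T "s # xs" j "length xs"] u
    by (auto simp: last_conv_nth)
  have "(u, h) \<notin> T\<^sup>*"
    using hu acyc \<open>u \<noteq> h\<close> by (meson acyclic_impl_antisym_rtrancl antisymD)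
  then have 1: "(u, h) \<notin> acyclic_part G zs T"
    using hu by (auto simp: acyclic_part_def tree_arcs_def forward_arcs_def cross_arcs_def tree_path_def)
  \<comment> \<open>Since \<open>h\<close> is not on \<open>s # ys\<close>, the path stays distinct
    when prolonged by \<open>h\<close>, and a search can take \<open>(u, h)\<close> as a tree
    arc.\<close>
  have "\<exists>zs' T'. dfst G s zs' T' \<and> set (zip (s # ys @ [h]) (ys @ [h])) \<subseteq> T'"
    using ys uh notin s by (intro dfst_along_path)
      (auto simp: successively_append_iff simp flip: append_Cons)
  then obtain zs' T' where T': "dfst G s zs' T'" "set (zip (s # ys @ [h]) (ys @ [h])) \<subseteq> T'"
    by blast
  have "(u, h) \<in> set (zip (s # ys @ [h]) (ys @ [h]))"
  proof -
    have "(s # ys @ [h]) ! length ys = u" "(ys @ [h]) ! length ys = h"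
      using ys(3) by (auto simp: last_conv_nth nth_Cons nth_append split: nat.splits if_splits)
    then show ?thesis
      unfolding set_zip by force
  qed
  then have "(u, h) \<in> acyclic_part G zs' T'"
    using T'(2) uh by (auto simp: acyclic_part_def tree_arcs_def)
  moreover have "acyclic_part G zs T = acyclic_part G zs' T'"
    using red T(1) T'(1) unfolding reducible_flow_graph_def by blast
  ultimately show False
    using 1 by blast
qed

section \<open>Breadth-first layers\<close>

text \<open>The value 0 stands for vertices that have not been reached.\<close>

definition bfs_layering :: "'a rel \<Rightarrow> 'a \<Rightarrow> ('a \<Rightarrow> nat) \<Rightarrow> bool" where
  "bfs_layering E s f \<longleftrightarrow> f s = 1 \<and>
     (\<forall>v. 0 < f v \<longrightarrow> v = s \<or> (\<exists>u. (u, v) \<in> E \<and> 0 < f u \<and> f v = Suc (f u))) \<and>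
     (\<forall>(u, v) \<in> E. 0 < f u \<longrightarrow> 0 < f v \<and> f v \<le> Suc (f u))"

text \<open>The union of the two subgraphs induced by the parity classes, so that a single
  topological order serves both.\<close>

definition same_parity_arcs :: "'a rel \<Rightarrow> ('a \<Rightarrow> nat) \<Rightarrow> 'a rel" where
  "same_parity_arcs E f = {(u, v) \<in> E. even (f u) \<longleftrightarrow> even (f v)}"

text \<open>The distance from \<open>s\<close> plus one is a layering. This serves the existence
  half of the result, for vertices of any type; the program constructs its own layering.\<close>

lemma bfs_layering_exists: "\<exists>f. bfs_layering E s f"
proof -
  define d where "d v = (LEAST k. (s, v) \<in> E ^^ k)" for v
  define f where "f v = (if (s, v) \<in> E\<^sup>* then Suc (d v) else 0)" for v
  have d: "(s, v) \<in> E ^^ d v" if "(s, v) \<in> E\<^sup>*" for v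
    using that LeastI_ex[of "\<lambda>k. (s, v) \<in> E ^^ k"] by (auto simp: d_def rtrancl_is_UN_relpow)
  have d_le: "d v \<le> k" if "(s, v) \<in> E ^^ k" for v k
    using that by (auto simp: d_def intro: Least_le)
  have arc: "f v \<le> Suc (f u)" if "(u, v) \<in> E" "(s, u) \<in> E\<^sup>*" for u v
    using d_le[of v "Suc (d u)"] d[OF that(2)] that by (auto simp: f_def)
  have "d s = 0" using d_le[of s 0] by simp
  have parent: "\<exists>u. (u, v) \<in> E \<and> 0 < f u \<and> f v = Suc (f u)" if "0 < f v" "v \<noteq> s" for v
  proof -
    have r: "(s, v) \<in> E\<^sup>*" using that by (simp add: f_def split: if_splits)
    show ?thesis
    proof (cases "d v")
      case 0
      then show ?thesis using d[OF r] that by simp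
    next
      case (Suc k)
      then obtain u where u: "(s, u) \<in> E ^^ k" "(u, v) \<in> E" using d[OF r] by auto
      then have ru: "(s, u) \<in> E\<^sup>*" by (auto simp: rtrancl_is_UN_relpow)
      moreover have "f v = Suc (f u)"
        using arc[OF u(2) ru] d_le[OF u(1)] ru r Suc by (simp add: f_def)
      ultimately show ?thesis using u by (auto simp: f_def)
    qed
  qed
  have "bfs_layering E s f"
    unfolding bfs_layering_def
  proof (intro conjI)
    show "f s = 1" using \<open>d s = 0\<close> by (simp add: f_def)
    show "\<forall>v. 0 < f v \<longrightarrow> v = s \<or> (\<exists>u. (u, v) \<in> E \<and> 0 < f u \<and> f v = Suc (f u))"
      using parent by blast
    have "0 < f v \<and> f v \<le> Suc (f u)" if "(u, v) \<in> E" "0 < f u" for u v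
    proof -
      have "(s, u) \<in> E\<^sup>*" using that by (simp add: f_def split: if_splits)
      then show ?thesis
        using arc[OF that(1)] that(1) by (auto simp: f_def intro: rtrancl_into_rtrancl)
    qed
    then show "\<forall>(u, v) \<in> E. 0 < f u \<longrightarrow> 0 < f v \<and> f v \<le> Suc (f u)"
      by blast
  qed
  then show ?thesis by blast
qed

lemma bfs_layering_reaches:
  assumes "bfs_layering E s f" "(s, v) \<in> E\<^sup>*"
  shows "0 < f v"
  using assms(2,1) by induction (auto simp: bfs_layering_def)

text \<open>Each step to a breadth-first parent lowers the layer. Starting at a vertex other than
  \<open>h\<close> and no deeper than \<open>h\<close>, the parents therefore never reach
  \<open>h\<close>.\<close>

lemma bfs_layering_path_avoiding:
  assumes f: "bfs_layering E s f" and "0 < f v" "f v \<le> f h" "v \<noteq> h"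
  shows "(s, v) \<in> {(a, b) \<in> E. a \<noteq> h \<and> b \<noteq> h}\<^sup>*"
  using assms(2-)
proof (induction "f v" arbitrary: v rule: less_induct)
  case less
  show ?case
  proof (cases "v = s")
    case False
    then obtain u where u: "(u, v) \<in> E" "0 < f u" "f v = Suc (f u)"
      using f less.prems by (auto simp: bfs_layering_def)
    have "(s, u) \<in> {(a, b) \<in> E. a \<noteq> h \<and> b \<noteq> h}\<^sup>*"
      using u less.prems by (intro less.hyps) auto
    moreover have "(u, v) \<in> {(a, b) \<in> E. a \<noteq> h \<and> b \<noteq> h}"
      using u less.prems by auto
    ultimately show ?thesis
      by (rule rtrancl_into_rtrancl)
  qed simp
qed

lemma (in pair_digraph) flow_graph_reachable:
  assumes "flow_graph G s" "v \<in> pverts G"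
  shows "(s, v) \<in> (parcs G)\<^sup>*"
proof (cases "v = s")
  case False
  then have "s \<rightarrow>\<^sup>*\<^bsub>with_proj G\<^esub> v"
    using assms by (simp add: flow_graph_def)
  then show ?thesis
    unfolding reachable_def by (simp add: rtrancl_on_rtranclI)
qed simp

text \<open>A set \<open>Q\<close> without sinks would contain a path that cannot be prolonged inside \<open>Q\<close>: its end
  \<open>u\<close> has an arc to an earlier vertex \<open>w\<close> of the path.\<close>

lemma (in pair_digraph) wf_converse_same_parity_arcs:
  assumes red: "reducible_flow_graph G s" and f: "bfs_layering (parcs G) s f"
  shows "wf ((same_parity_arcs (parcs G) f)\<inverse>)"
proof (rule wfI_min, rule ccontr)
  define E R where "E = parcs G" and "R = same_parity_arcs (parcs G) f"
  have RE: "(u, v) \<in> E" "even (f u) \<longleftrightarrow> even (f v)" if "(u, v) \<in> R" for u v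
    using that by (auto simp: R_def E_def same_parity_arcs_def)
  have flow: "flow_graph G s"
    using red by (simp add: reducible_flow_graph_def)
  fix q Q
  assume "q \<in> Q" and "\<not> (\<exists>z \<in> Q. \<forall>y. (y, z) \<in> (same_parity_arcs (parcs G) f)\<inverse> \<longrightarrow> y \<notin> Q)"
  then have succ: "\<exists>y \<in> Q. (z, y) \<in> R" if "z \<in> Q" for z
    using that unfolding R_def by blast
  have QV: "Q \<subseteq> pverts G"
  proof
    fix z
    assume "z \<in> Q"
    then obtain y where "(z, y) \<in> E" using succ RE(1) by blast
    then show "z \<in> pverts G" unfolding E_def by (rule in_arcsD1)
  qed
  have reach: "(s, v) \<in> E\<^sup>*" if "v \<in> Q" for v
    using flow_graph_reachable[OF flow] that QV by (auto simp: E_def)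
  obtain xs where xs: "distinct (s # xs)" "successively (\<lambda>u v. (u, v) \<in> E) (s # xs)"
    "last (s # xs) = q"
    using rtrancl_imp_distinct_path[OF reach[OF \<open>q \<in> Q\<close>]] by blast
  have "\<exists>v \<in> set (s # xs). v \<in> Q"
    using xs(3) \<open>q \<in> Q\<close> last_in_set[of "s # xs"] by auto
  \<comment> \<open>Cutting at the first vertex in \<open>Q\<close> keeps \<open>ps\<close> outside
    \<open>Q\<close>, so a continuation inside \<open>Q\<close> cannot run into
    \<open>ps\<close>.\<close>
  then obtain ps c rs where split: "s # xs = ps @ c # rs" and c: "c \<in> Q"
    and ps: "\<And>v. v \<in> set ps \<Longrightarrow> v \<notin> Q"
    using split_list_first_prop[of "s # xs" "\<lambda>v. v \<in> Q"] by auto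
  define good where "good cs \<longleftrightarrow> distinct (ps @ cs) \<and> successively (\<lambda>u v. (u, v) \<in> E) (ps @ cs) \<and>
    cs \<noteq> [] \<and> hd (ps @ cs) = s \<and> set cs \<subseteq> Q \<and> successively (\<lambda>u v. (u, v) \<in> R) cs" for cs
  have "good [c]"
    using xs(1,2) c split unfolding good_def
    by (auto simp: successively_append_iff) (metis append_Nil hd_append list.sel(1))+
  moreover have "length cs < Suc (card (pverts G))" if "good cs" for cs
  proof -
    have "length cs = card (set cs)"
      using that by (simp add: good_def distinct_card)
    also have "\<dots> \<le> card (pverts G)"
      using that QV by (intro card_mono) (auto simp: good_def)
    finally show ?thesis by simp
  qed
  \<comment> \<open>A longest continuation exists because its length is bounded by the number of
    vertices.\<close>
  ultimately obtain cs where cs: "good cs" and max: "\<And>ds. good ds \<Longrightarrow> length ds \<le> length cs"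
    using ex_has_greatest_nat[of good "[c]" length] by blast
  define u where "u = last cs"
  have "u \<in> Q"
    using cs by (auto simp: good_def u_def)
  then obtain w where w: "w \<in> Q" "(u, w) \<in> R"
    using succ by blast
  have "w \<in> set cs"
  proof (rule ccontr)
    assume "w \<notin> set cs"
    then have "good (cs @ [w])"
      using cs w ps RE(1) unfolding good_def
      by (auto simp: successively_append_iff u_def hd_append)
    then show False
      using max by fastforce
  qed
  then obtain j where j: "j < length cs" "cs ! j = w"
    by (auto simp: in_set_conv_nth)
  have "u \<noteq> w"
    using RE(1)[OF w(2)] no_loops' by (auto simp: E_def)
  then have Suc_j: "Suc j < length cs"
    using j cs by (metis Suc_lessI diff_Suc_1 good_def last_conv_nth u_def)
  define x where "x = cs ! Suc j"
  have "(w, x) \<in> R"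
    using cs Suc_j j by (auto simp: good_def successively_conv_nth x_def)
  have "0 < f w"
    using bfs_layering_reaches[OF f] reach w(1) by (simp add: E_def)
  \<comment> \<open>Equal parity excludes \<open>f x = Suc (f w)\<close>, so \<open>x\<close> is no
    deeper than \<open>w\<close> and its breadth-first path avoids \<open>w\<close>.\<close>
  then have "0 < f x" "f x \<le> Suc (f w)"
    using f RE(1)[OF \<open>(w, x) \<in> R\<close>] by (auto simp: bfs_layering_def E_def)
  moreover have "f x \<noteq> Suc (f w)"
    using RE(2)[OF \<open>(w, x) \<in> R\<close>] by auto
  moreover have "x \<noteq> w"
    using RE(1)[OF \<open>(w, x) \<in> R\<close>] no_loops' by (auto simp: E_def)
  moreover define Ew where "Ew = {(a, b) \<in> E. a \<noteq> w \<and> b \<noteq> w}"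
  ultimately have sx: "(s, x) \<in> Ew\<^sup>*"
    using bfs_layering_path_avoiding[OF f, of x w] by (simp add: E_def)
  have dist: "cs ! i \<noteq> w" if "j < i" "i < length cs" for i
    using cs that j by (auto simp: good_def nth_eq_iff_index_eq)
  \<comment> \<open>From \<open>x\<close> on, the distinct path \<open>cs\<close> does not return to
    \<open>w\<close>; so \<open>u\<close> too is reachable without passing through
    \<open>w\<close>.\<close>
  have "successively (\<lambda>a b. (a, b) \<in> Ew) (drop (Suc j) cs)"
    using cs dist RE(1) by (auto simp: successively_conv_nth good_def Ew_def)
  note * = successively_nth_rtrancl[OF this, of 0 "length cs - Suc (Suc j)"]
  have "(x, cs ! (length cs - 1)) \<in> Ew\<^sup>*"
  proof -
    have "Suc j + (length cs - Suc (Suc j)) = length cs - 1" using Suc_j by simp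
    then show ?thesis using * Suc_j by (simp add: x_def diff_less_mono2)
  qed
  moreover have "cs ! (length cs - 1) = u"
    using cs by (auto simp: good_def u_def last_conv_nth)
  ultimately have "(x, u) \<in> Ew\<^sup>*"
    by simp
  with sx have "(s, u) \<in> Ew\<^sup>*"
    by (rule rtrancl_trans)
  then obtain ys where ys: "distinct (s # ys)" "successively (\<lambda>a b. (a, b) \<in> Ew) (s # ys)"
    "last (s # ys) = u"
    using rtrancl_imp_distinct_path by metis
  \<comment> \<open>Every vertex but the last is the tail of an arc in \<open>Ew\<close>. The last
    one is \<open>u\<close>, which needs its own argument because the path may have no arcs.\<close>
  have "(s # ys) ! i \<noteq> w" if "i < length (s # ys)" for i
  proof (cases "i = length ys")
    case True
    then show ?thesis
      using ys(3) \<open>u \<noteq> w\<close> last_conv_nth[of "s # ys"] by (simp del: last.simps)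
  next
    case False
    then have "((s # ys) ! i, (s # ys) ! Suc i) \<in> Ew"
      using ys(2) that by (simp only: successively_conv_nth) simp
    then show ?thesis by (simp add: Ew_def)
  qed
  then have "w \<notin> set (s # ys)"
    by (metis in_set_conv_nth)
  moreover have "successively (\<lambda>a b. (a, b) \<in> parcs G) (s # ys)"
    using ys(2) by (rule successively_mono) (auto simp: Ew_def E_def)
  moreover obtain zs where zs: "ps @ cs = s # zs"
    using cs unfolding good_def by (metis append_is_Nil_conv hd_Cons_tl)
  ultimately show False
    using cycle_arc_head_on_path[OF red, of zs u w ys] cs ys(1,3) RE(1)[OF w(2)] \<open>w \<in> set cs\<close>
    unfolding good_def zs[symmetric] by (auto simp: u_def E_def)
qed

text \<open>Acyclicity does not depend on the direction of the arcs, and for a finite relation it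
  yields well-foundedness.\<close>

lemma (in pair_digraph) wf_same_parity_arcs:
  assumes "reducible_flow_graph G s" "bfs_layering (parcs G) s f"
  shows "wf (same_parity_arcs (parcs G) f)"
proof (rule finite_acyclic_wf)
  show "finite (same_parity_arcs (parcs G) f)"
    by (rule finite_subset[of _ "parcs G"]) (auto simp: same_parity_arcs_def)
  show "acyclic (same_parity_arcs (parcs G) f)"
    using wf_acyclic[OF wf_converse_same_parity_arcs[OF assms]] by simp
qed

section \<open>From topological orders to LR-orders\<close>

text \<open>The list may be partial, but it is closed under predecessors. This makes the property an
  invariant of greedy placement.\<close>

definition topological :: "'a rel \<Rightarrow> 'a list \<Rightarrow> bool" where
  "topological R xs \<longleftrightarrow> distinct xs \<and>
     (\<forall>i < length xs. \<forall>u. (u, xs ! i) \<in> R \<longrightarrow> u \<in> set (take i xs))"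

lemma topological_snoc:
  assumes "topological R xs" "w \<notin> set xs" "\<And>u. (u, w) \<in> R \<Longrightarrow> u \<in> set xs"
  shows "topological R (xs @ [w])"
  using assms by (auto simp: topological_def nth_append less_Suc_eq)

text \<open>A minimal unlisted vertex will do. Both the abstract construction and the program rely
  on this to proceed.\<close>

lemma topological_extendable:
  assumes "wf R" "R \<subseteq> V \<times> V" "\<not> V \<subseteq> set xs"
  shows "\<exists>w \<in> V - set xs. \<forall>u. (u, w) \<in> R \<longrightarrow> u \<in> set xs"
proof -
  obtain v where "v \<in> V - set xs" using assms(3) by blast
  with assms(1) obtain w where "w \<in> V - set xs" "\<And>u. (u, w) \<in> R \<Longrightarrow> u \<notin> V - set xs"
    unfolding wf_eq_minimal by metis
  then show ?thesis using assms(2) by blast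
qed

lemma topological_exists:
  assumes "finite V" "wf R" "R \<subseteq> V \<times> V"
  shows "\<exists>xs. topological R xs \<and> set xs = V"
proof -
  have "\<exists>xs. topological R xs \<and> set xs \<subseteq> V \<and> length xs = k" if "k \<le> card V" for k
    using that
  proof (induction k)
    case 0
    show ?case by (simp add: topological_def)
  next
    case (Suc k)
    then obtain xs where xs: "topological R xs" "set xs \<subseteq> V" "length xs = k" by auto
    have "\<not> V \<subseteq> set xs"
      using Suc.prems xs(3) card_mono[of "set xs" V] card_length[of xs] by auto
    from topological_extendable[OF assms(2,3) this] obtain w where
      "w \<in> V - set xs" "\<And>u. (u, w) \<in> R \<Longrightarrow> u \<in> set xs" by blast
    then show ?case
      using xs topological_snoc[of R xs w] by (intro exI[of _ "xs @ [w]"]) auto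
  qed
  then obtain xs where "topological R xs" "set xs \<subseteq> V" "length xs = card V" by blast
  then show ?thesis
    using assms(1) by (metis card_subset_eq distinct_card topological_def)
qed

section \<open>Lists as strict linear orders\<close>

lemma list_order_Nil [simp]: "list_order [] = {}"
  by (simp add: list_order_def)

lemma list_order_Cons [simp]: "list_order (x # xs) = {x} \<times> set xs \<union> list_order xs"
proof (intro equalityI subrelI)
  fix a b
  assume "(a, b) \<in> list_order (x # xs)"
  then obtain i j where ij: "i < j" "j < Suc (length xs)" "a = (x # xs) ! i" "b = (x # xs) ! j"
    by (auto simp: list_order_def)
  then obtain j' where j': "j = Suc j'" by (cases j) auto
  show "(a, b) \<in> {x} \<times> set xs \<union> list_order xs"
    using ij j' by (cases i) (auto simp: list_order_def)
next
  fix a b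
  assume "(a, b) \<in> {x} \<times> set xs \<union> list_order xs"
  then consider j where "a = x" "j < length xs" "b = xs ! j"
    | i j where "i < j" "j < length xs" "a = xs ! i" "b = xs ! j"
    by (auto simp: list_order_def in_set_conv_nth)
  then show "(a, b) \<in> list_order (x # xs)"
  proof cases
    case 1
    then show ?thesis unfolding list_order_def
      by (intro CollectI exI[of _ 0] exI[of _ "Suc j"]) simp
  next
    case 2
    then show ?thesis unfolding list_order_def
      by (intro CollectI exI[of _ "Suc i"] exI[of _ "Suc j"]) simp
  qed
qed

lemma list_order_append [simp]:
  "list_order (xs @ ys) = list_order xs \<union> list_order ys \<union> set xs \<times> set ys"
  by (induction xs) auto

lemma list_order_rev [simp]: "list_order (rev xs) = (list_order xs)\<inverse>"
  by (induction xs) auto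

lemma list_order_subset: "list_order xs \<subseteq> set xs \<times> set xs"
  by (induction xs) auto

lemma list_order_filter:
  "(u, v) \<in> list_order xs \<Longrightarrow> P u \<Longrightarrow> P v \<Longrightarrow> (u, v) \<in> list_order (filter P xs)"
  by (induction xs) auto

lemma strict_linear_order_on_list_order:
  assumes "distinct xs"
  shows "strict_linear_order_on (set xs) (list_order xs)"
  using assms
proof (induction xs)
  case (Cons x xs)
  then show ?case
    using list_order_subset[of xs]
    by (auto simp: strict_linear_order_on_def trans_def irrefl_def total_on_def)
qed (simp add: strict_linear_order_on_def trans_def irrefl_def total_on_def)

lemma topological_list_order:
  assumes "topological R xs" "(u, v) \<in> R" "v \<in> set xs"
  shows "(u, v) \<in> list_order xs"
proof -
  obtain i where "i < length xs" "xs ! i = v" using assms(3) by (auto simp: in_set_conv_nth)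
  moreover from this have "u \<in> set (take i xs)"
    using assms(1,2) by (auto simp: topological_def)
  then obtain k where "k < i" "xs ! k = u"
    by (auto simp: in_set_conv_nth)
  ultimately show ?thesis by (auto simp: list_order_def)
qed

definition lr_list :: "('a \<Rightarrow> bool) \<Rightarrow> 'a list \<Rightarrow> 'a list" where
  "lr_list P xs = filter P xs @ rev (filter (\<lambda>v. \<not> P v) xs)"

lemma set_lr_list [simp]: "set (lr_list P xs) = set xs"
  by (auto simp: lr_list_def)

lemma distinct_lr_list [simp]: "distinct xs \<Longrightarrow> distinct (lr_list P xs)"
  by (auto simp: lr_list_def)

text \<open>Successors of an odd vertex stand to its right: those in its class by the topological
  order, the others because the whole even class follows. For even vertices the reversal mirrors
  this.\<close>

lemma (in pair_digraph) lr_order_lr_list: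
  assumes xs: "topological (same_parity_arcs (parcs G) f) xs" "set xs = pverts G"
  shows "lr_order G (list_order (lr_list (\<lambda>v. odd (f v)) xs))"
proof -
  define P where "P v = odd (f v)" for v
  have "distinct xs" using xs(1) by (simp add: topological_def)
  have same: "(u, v) \<in> list_order xs" if "(u, v) \<in> parcs G" "P u \<longleftrightarrow> P v" for u v
    using topological_list_order[OF xs(1), of u v] that xs(2)
    by (auto simp: same_parity_arcs_def P_def dest: in_arcsD2)
  have right: "(v, w) \<in> list_order (lr_list P xs)" if "(v, w) \<in> parcs G" "P v" for v w
    using that xs(2) same[of v w] list_order_filter[of v w xs P]
    by (cases "P w") (auto simp: lr_list_def dest: in_arcsD1 in_arcsD2)
  have left: "(w, v) \<in> list_order (lr_list P xs)" if "(v, w) \<in> parcs G" "\<not> P v" for v w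
    using that xs(2) same[of v w] list_order_filter[of v w xs "\<lambda>v. \<not> P v"]
    by (cases "P w") (auto simp: lr_list_def dest: in_arcsD1 in_arcsD2)
  have "lr_order G (list_order (lr_list P xs))"
    unfolding lr_order_def
    using left right list_order_subset[of "lr_list P xs"]
      strict_linear_order_on_list_order[of "lr_list P xs"] \<open>distinct xs\<close> xs(2)
    by auto
  then show ?thesis unfolding P_def .
qed

lemma (in pair_digraph) same_parity_arcs_subset:
  "same_parity_arcs (parcs G) f \<subseteq> pverts G \<times> pverts G"
  by (auto simp: same_parity_arcs_def dest: in_arcsD1 in_arcsD2)

lemma (in pair_digraph) lr_order_exists:
  assumes "reducible_flow_graph G s"
  shows "\<exists>r. lr_order G r"
proof -
  obtain f where f: "bfs_layering (parcs G) s f"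
    using bfs_layering_exists[of "parcs G" s] by (elim exE)
  note wf = wf_same_parity_arcs[OF assms f]
  obtain xs where "topological (same_parity_arcs (parcs G) f) xs" "set xs = pverts G"
    using topological_exists[OF pair_finite_verts wf same_parity_arcs_subset] by (elim exE conjE)
  from lr_order_lr_list[OF this] show ?thesis by (rule exI)
qed

section \<open>Running times of programs\<close>

text \<open>Total correctness with an upper bound on the time, so that bounds can be weakened and
  combined freely.\<close>

definition halts :: "com \<Rightarrow> memory \<Rightarrow> nat \<Rightarrow> (memory \<Rightarrow> bool) \<Rightarrow> bool" where
  "halts c m k Q \<longleftrightarrow> (\<exists>t m'. exec c m t m' \<and> t \<le> k \<and> Q m')"

lemma halts_mono:
  "halts c m k Q \<Longrightarrow> k \<le> l \<Longrightarrow> (\<And>m'. Q m' \<Longrightarrow> Q' m') \<Longrightarrow> halts c m l Q'"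
  unfolding halts_def by (meson le_trans)

lemma halts_Seq:
  assumes "halts c m k (\<lambda>m'. halts d m' l Q)"
  shows "halts (Seq c d) m (1 + k + l) Q"
proof -
  from assms obtain t m' u m'' where "exec c m t m'" "t \<le> k" "exec d m' u m''" "u \<le> l" "Q m''"
    unfolding halts_def by blast
  moreover from this have "exec (Seq c d) m (1 + t + u) m''"
    by (intro exec.Seq)
  ultimately show ?thesis
    unfolding halts_def by (intro exI[of _ "1 + t + u"] exI[of _ m'']) simp
qed

lemma halts_SeqI:
  "halts c m k R \<Longrightarrow> (\<And>m'. R m' \<Longrightarrow> halts d m' l Q) \<Longrightarrow> halts (Seq c d) m (1 + k + l) Q"
  by (rule halts_Seq) (erule halts_mono, auto)

fun loop_free :: "com \<Rightarrow> bool" where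
  "loop_free Skip \<longleftrightarrow> True"
| "loop_free (Assign a i e) \<longleftrightarrow> True"
| "loop_free (Seq c d) \<longleftrightarrow> loop_free c \<and> loop_free d"
| "loop_free (Cond b c d) \<longleftrightarrow> loop_free c \<and> loop_free d"
| "loop_free (While b c) \<longleftrightarrow> False"

text \<open>The values of \<open>result\<close> and \<open>ccost\<close> on loops are junk.\<close>

fun result :: "com \<Rightarrow> memory \<Rightarrow> memory" where
  "result Skip m = m"
| "result (Assign a i e) m = m(a := (m a)(aval i m := aval e m))"
| "result (Seq c d) m = result d (result c m)"
| "result (Cond b c d) m = (if bval b m then result c m else result d m)"
| "result (While b c) m = m"

fun ccost :: "com \<Rightarrow> nat" where
  "ccost Skip = 1"
| "ccost (Assign a i e) = 1 + acost i + acost e"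
| "ccost (Seq c d) = 1 + ccost c + ccost d"
| "ccost (Cond b c d) = 1 + bcost b + ccost c + ccost d"
| "ccost (While b c) = 0"

text \<open>Loop-free code can thus be run symbolically by simplification with
  \<open>result\<close>. \<open>ccost\<close> charges both branches of a conditional, so it only
  bounds the time.\<close>

lemma exec_loop_free:
  assumes "loop_free c"
  shows "\<exists>t \<le> ccost c. exec c m t (result c m)"
  using assms
proof (induction c arbitrary: m)
  case Skip
  have "exec Skip m (ccost Skip) (result Skip m)"
    unfolding ccost.simps result.simps by (rule exec.Skip)
  then show ?case by blast
next
  case (Assign a i e)
  have "exec (Assign a i e) m (ccost (Assign a i e)) (result (Assign a i e) m)"
    unfolding ccost.simps result.simps by (rule exec.Assign)
  then show ?case by blast
next
  case (Seq c d)
  then obtain t u where "t \<le> ccost c" "exec c m t (result c m)"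
    "u \<le> ccost d" "exec d (result c m) u (result d (result c m))"
    by (metis loop_free.simps(3))
  moreover from this have "exec (Seq c d) m (1 + t + u) (result (Seq c d) m)"
    unfolding result.simps by (intro exec.Seq)
  ultimately show ?case by (intro exI[of _ "1 + t + u"]) simp
next
  case (Cond b c d)
  show ?case
  proof (cases "bval b m")
    case True
    obtain t where "t \<le> ccost c" "exec c m t (result c m)"
      using Cond by (metis loop_free.simps(4))
    moreover from this True have "exec (Cond b c d) m (1 + bcost b + t) (result c m)"
      by (intro exec.CondTrue)
    ultimately show ?thesis using True by (intro exI[of _ "1 + bcost b + t"]) simp
  next
    case False
    obtain t where "t \<le> ccost d" "exec d m t (result d m)"
      using Cond by (metis loop_free.simps(4))
    moreover from this False have "exec (Cond b c d) m (1 + bcost b + t) (result d m)"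
      by (intro exec.CondFalse)
    ultimately show ?thesis using False by (intro exI[of _ "1 + bcost b + t"]) simp
  qed
qed simp

lemma halts_loop_free: "loop_free c \<Longrightarrow> Q (result c m) \<Longrightarrow> halts c m (ccost c) Q"
  using exec_loop_free unfolding halts_def by blast

lemma halts_loop_free_Seq:
  "loop_free c \<Longrightarrow> halts d (result c m) l Q \<Longrightarrow> halts (Seq c d) m (1 + ccost c + l) Q"
  by (rule halts_Seq) (rule halts_loop_free)

text \<open>The invariant is indexed by the number of completed rounds. The final failing test is
  charged as a full round, hence the factor \<open>Suc N\<close>.\<close>

lemma halts_While:
  assumes "I 0 m"
    and "\<And>j m. j < N \<Longrightarrow> I j m \<Longrightarrow> bval b m \<and> halts c m k (I (Suc j))"
    and "\<And>m. I N m \<Longrightarrow> \<not> bval b m"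
  shows "halts (While b c) m (Suc N * (1 + bcost b + k)) (I N)"
proof -
  \<comment> \<open>Here \<open>i\<close> counts the rounds still to come.\<close>
  have "halts (While b c) m (Suc i * (1 + bcost b + k)) (I N)" if "i \<le> N" "I (N - i) m" for i m
    using that
  proof (induction i arbitrary: m)
    case 0
    then have "exec (While b c) m (1 + bcost b) m"
      using assms(3) by (intro exec.WhileFalse) simp
    then show ?case
      using 0 unfolding halts_def by (intro exI[of _ "1 + bcost b"] exI[of _ m]) simp
  next
    case (Suc i)
    then have step: "bval b m \<and> halts c m k (I (Suc (N - Suc i)))"
      by (intro assms(2)) auto
    then obtain t m' where t: "exec c m t m'" "t \<le> k" "I (N - i) m'"
      using Suc.prems unfolding halts_def by (auto simp: Suc_diff_Suc)
    then obtain u m'' where u: "exec (While b c) m' u m''" "u \<le> Suc i * (1 + bcost b + k)" "I N m''"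
      using Suc.IH[of m'] Suc.prems unfolding halts_def by auto
    have "exec (While b c) m (1 + bcost b + t + u) m''"
      using step t u by (intro exec.WhileTrue) auto
    then show ?case
      using t u unfolding halts_def
      by (intro exI[of _ "1 + bcost b + t + u"] exI[of _ m'']) simp
  qed
  from this[of N m] assms(1) show ?thesis by simp
qed

abbreviation var :: "string \<Rightarrow> aexp" where
  "var x \<equiv> Read x (Const 0)"

abbreviation set_var :: "string \<Rightarrow> aexp \<Rightarrow> com" where
  "set_var x e \<equiv> Assign x (Const 0) e"

definition for_loop :: "string \<Rightarrow> nat \<Rightarrow> nat \<Rightarrow> aexp \<Rightarrow> com \<Rightarrow> com" where
  "for_loop i a d e c = Seq (set_var i (Const a))
     (While (Less (var i) e) (Seq c (set_var i (Add (var i) (Const d)))))"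

text \<open>A common majorant \<open>K\<close> of all iteration counts gives every loop a bound of
  the same form, so that nested loops yield a polynomial in \<open>K\<close>.\<close>

lemma halts_for_loop:
  assumes start: "I 0 m"
    and counter: "\<And>j m x. I j m \<Longrightarrow> I j (m(i := x))"
    and bound: "\<And>j m. I j m \<Longrightarrow> m i 0 = a + d * j \<Longrightarrow> m i 0 < aval e m \<longleftrightarrow> j < N"
    and body: "\<And>j m. j < N \<Longrightarrow> I j m \<Longrightarrow> m i 0 = a + d * j \<Longrightarrow>
      halts c m k (\<lambda>m'. I (Suc j) m' \<and> m' i 0 = a + d * j)"
    and "acost e = 2" "Suc N \<le> K"
  shows "halts (for_loop i a d e c) m (K * (k + 17)) (I N)"
proof -
  define J where "J j m \<longleftrightarrow> I j m \<and> m i 0 = a + d * j" for j m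
  have incr: "halts (Seq c (set_var i (Add (var i) (Const d)))) m (1 + k + 6) (J (Suc j))"
    if "j < N" "J j m" for j m
  proof (rule halts_Seq, rule halts_mono[OF body[OF \<open>j < N\<close>]])
    fix m'
    assume m': "I (Suc j) m' \<and> m' i 0 = a + d * j"
    have "halts (set_var i (Add (var i) (Const d))) m'
        (ccost (set_var i (Add (var i) (Const d)))) (J (Suc j))"
      using m' counter by (intro halts_loop_free) (auto simp: J_def)
    then show "halts (set_var i (Add (var i) (Const d))) m' 6 (J (Suc j))"
      by (simp add: eval_nat_numeral)
  qed (use that in \<open>auto simp: J_def\<close>)
  have "halts (While (Less (var i) e) (Seq c (set_var i (Add (var i) (Const d)))))
      (result (set_var i (Const a)) m) (Suc N * (1 + bcost (Less (var i) e) + (1 + k + 6))) (J N)"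
  proof (rule halts_While)
    show "J 0 (result (set_var i (Const a)) m)"
      using start counter by (simp add: J_def)
    show "bval (Less (var i) e) m \<and> halts (Seq c (set_var i (Add (var i) (Const d)))) m
        (1 + k + 6) (J (Suc j))" if "j < N" "J j m" for j m
      using incr[OF that] bound[of j m] that by (simp add: J_def)
    show "\<not> bval (Less (var i) e) m" if "J N m" for m
      using bound[of N m] that by (simp add: J_def)
  qed
  then have "halts (set_var i (Const a)) m (ccost (set_var i (Const a)))
      (\<lambda>m. halts (While (Less (var i) e) (Seq c (set_var i (Add (var i) (Const d))))) m
         (Suc N * (1 + bcost (Less (var i) e) + (1 + k + 6))) (J N))"
    by (intro halts_loop_free) auto
  note run = halts_Seq[OF this]
  show ?thesis
    unfolding for_loop_def
  proof (rule halts_mono[OF run])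
    \<comment> \<open>Initialisation costs 4 and each round \<open>k + 13\<close>; adding the 4 to
      every round gives the 17.\<close>
    have "1 + ccost (set_var i (Const a)) + Suc N * (1 + bcost (Less (var i) e) + (1 + k + 6)) =
        4 + Suc N * (k + 13)"
      using \<open>acost e = 2\<close> by (simp add: eval_nat_numeral)
    also have "\<dots> \<le> Suc N * (k + 17)"
      by (simp add: algebra_simps)
    also have "\<dots> \<le> K * (k + 17)"
      using \<open>Suc N \<le> K\<close> by (intro mult_right_mono) auto
    finally show "1 + ccost (set_var i (Const a)) +
        Suc N * (1 + bcost (Less (var i) e) + (1 + k + 6)) \<le> K * (k + 17)" .
  qed (simp add: J_def)
qed

section \<open>The input graph in memory and loops over its arcs and vertices\<close>

definition encoding :: "nat \<Rightarrow> nat \<Rightarrow> (nat \<times> nat) list \<Rightarrow> nat list" where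
  "encoding n s es = n # s # concat (map (\<lambda>(v, w). [v, w]) es)"

text \<open>Only the array \<open>input\<close> is constrained, and the programs below never write
  to it.\<close>

definition stores_graph :: "nat \<Rightarrow> nat \<Rightarrow> (nat \<times> nat) list \<Rightarrow> memory \<Rightarrow> bool" where
  "stores_graph n s es m \<longleftrightarrow> m ''input'' = input_memory (encoding n s es) ''input''"

lemma length_encoding: "length (encoding n s es) = 2 + 2 * length es"
  by (induction es) (auto simp: encoding_def)

lemma nth_arcs:
  assumes "j < length es"
  shows "concat (map (\<lambda>(v, w). [v, w]) es) ! (2 * j) = fst (es ! j)"
    "concat (map (\<lambda>(v, w). [v, w]) es) ! Suc (2 * j) = snd (es ! j)"
  using assms
proof (induction es arbitrary: j)
  case (Cons e es)
  {
    case 1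
    then show ?case using Cons.IH(1) by (cases j) (auto split: prod.splits)
  next
    case 2
    then show ?case using Cons.IH(2) by (cases j) (auto split: prod.splits)
  }
qed auto

lemma stores_graph_reads:
  assumes "stores_graph n s es m"
  shows "m ''input'' 0 = 2 + 2 * length es" "m ''input'' 1 = n" "m ''input'' 2 = s"
    and "j < length es \<Longrightarrow> m ''input'' (3 + 2 * j) = fst (es ! j)"
    and "j < length es \<Longrightarrow> m ''input'' (4 + 2 * j) = snd (es ! j)"
proof -
  note m = assms[unfolded stores_graph_def]
  show "m ''input'' 0 = 2 + 2 * length es"
    by (simp add: m input_memory_def length_encoding)
  show "m ''input'' 1 = n" "m ''input'' 2 = s"
    by (simp_all add: m input_memory_def encoding_def)
  assume j: "j < length es"
  have len: "4 + 2 * j \<le> length (encoding n s es)"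
    using j by (simp add: length_encoding)
  show "m ''input'' (3 + 2 * j) = fst (es ! j)" "m ''input'' (4 + 2 * j) = snd (es ! j)"
    using len j nth_arcs[OF j]
    by (simp_all add: m input_memory_def encoding_def eval_nat_numeral)
qed

text \<open>The counter is the address of a tail: arc \<open>j\<close> occupies cells
  \<open>3 + 2 * j\<close> and \<open>4 + 2 * j\<close>. Cell 0 holds
  \<open>2 + 2 * length es\<close>, which exceeds \<open>3 + 2 * j\<close> exactly for
  \<open>j < length es\<close>.\<close>

definition for_arcs :: "com \<Rightarrow> com" where
  "for_arcs = for_loop ''arc'' 3 2 (var ''input'')"

definition for_vertices :: "string \<Rightarrow> com \<Rightarrow> com" where
  "for_vertices i = for_loop i 0 1 (Read ''input'' (Const 1))"

abbreviation arc_tail :: aexp where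
  "arc_tail \<equiv> Read ''input'' (var ''arc'')"

abbreviation arc_head :: aexp where
  "arc_head \<equiv> Read ''input'' (Add (var ''arc'') (Const 1))"

lemma halts_for_arcs:
  assumes start: "I 0 m"
    and stores: "\<And>j m. I j m \<Longrightarrow> stores_graph n s es m"
    and counter: "\<And>j m x. I j m \<Longrightarrow> I j (m(''arc'' := x))"
    and body: "\<And>j m. j < length es \<Longrightarrow> I j m \<Longrightarrow> aval arc_tail m = fst (es ! j) \<Longrightarrow>
      aval arc_head m = snd (es ! j) \<Longrightarrow>
      halts c m k (\<lambda>m'. I (Suc j) m' \<and> m' ''arc'' = m ''arc'')"
    and "Suc (length es) \<le> K"
  shows "halts (for_arcs c) m (K * (k + 17)) (I (length es))"
  unfolding for_arcs_def
proof (rule halts_for_loop)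
  show "m ''arc'' 0 < aval (var ''input'') m \<longleftrightarrow> j < length es"
    if "I j m" "m ''arc'' 0 = 3 + 2 * j" for j m
    using stores_graph_reads(1)[OF stores[OF that(1)]] that(2) by auto
  show "halts c m k (\<lambda>m'. I (Suc j) m' \<and> m' ''arc'' 0 = 3 + 2 * j)"
    if "j < length es" "I j m" "m ''arc'' 0 = 3 + 2 * j" for j m
    using stores_graph_reads(4,5)[OF stores[OF that(2)] that(1)] that
    by (intro halts_mono[OF body]) (auto simp: eval_nat_numeral)
qed (simp_all add: start counter assms(5) del: fun_upd_apply)

lemma halts_for_vertices:
  assumes start: "I 0 m"
    and stores: "\<And>j m. I j m \<Longrightarrow> stores_graph n s es m"
    and counter: "\<And>j m x. I j m \<Longrightarrow> I j (m(i := x))"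
    and body: "\<And>j m. j < n \<Longrightarrow> I j m \<Longrightarrow> m i 0 = j \<Longrightarrow>
      halts c m k (\<lambda>m'. I (Suc j) m' \<and> m' i = m i)"
    and "Suc n \<le> K"
  shows "halts (for_vertices i c) m (K * (k + 17)) (I n)"
  unfolding for_vertices_def
proof (rule halts_for_loop)
  show "m i 0 < aval (Read ''input'' (Const 1)) m \<longleftrightarrow> j < n"
    if "I j m" "m i 0 = 0 + 1 * j" for j m
    using stores_graph_reads(2)[OF stores[OF that(1)]] that(2) by auto
  show "halts c m k (\<lambda>m'. I (Suc j) m' \<and> m' i 0 = 0 + 1 * j)"
    if "j < n" "I j m" "m i 0 = 0 + 1 * j" for j m
    using that by (intro halts_mono[OF body]) auto
qed (simp_all add: start counter assms(5) del: fun_upd_apply)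

section \<open>Computing the layers\<close>

text \<open>The invariant of breadth-first search in round \<open>r\<close>, when the arcs in \<open>D\<close> have been
  processed. Layers are numbered from 1.\<close>

definition layering_upto ::
  "'a rel \<Rightarrow> nat \<Rightarrow> 'a rel \<Rightarrow> 'a \<Rightarrow> ('a \<Rightarrow> nat) \<Rightarrow> bool" where
  "layering_upto E r D s f \<longleftrightarrow> f s = 1 \<and> (\<forall>v. f v \<le> r + 2) \<and>
     (\<forall>v. 0 < f v \<longrightarrow> v = s \<or> (\<exists>u. (u, v) \<in> E \<and> 0 < f u \<and> f v = Suc (f u))) \<and>
     (\<forall>(u, v) \<in> E. 0 < f u \<and> f u \<le> r \<longrightarrow> 0 < f v \<and> f v \<le> Suc (f u)) \<and>
     (\<forall>(u, v) \<in> D. f u = Suc r \<longrightarrow> 0 < f v)"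

lemma layering_upto_start: "layering_upto E 0 {} s ((\<lambda>_. 0)(s := 1))"
  by (auto simp: layering_upto_def)

text \<open>Once all arcs are processed, every successor of layer \<open>Suc r\<close> is reached,
  and the general bound \<open>r + 2\<close> is just what the next round requires of it.\<close>

lemma layering_upto_next:
  assumes "layering_upto E r E s f"
  shows "layering_upto E (Suc r) {} s f"
  using assms unfolding layering_upto_def by (fastforce simp: le_Suc_eq)

text \<open>A vertex that receives layer \<open>r + 2\<close> had value 0, so it was nobody's
  parent; its own outgoing arcs carry no obligation in this round because \<open>r + 2\<close>
  exceeds \<open>Suc r\<close>.\<close>

lemma layering_upto_arc:
  assumes f: "layering_upto E r D s f" and uv: "(u, v) \<in> E"
  shows "layering_upto E r (insert (u, v) D) s
    (if f u = Suc r \<and> f v = 0 then f(v := r + 2) else f)"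
proof (cases "f u = Suc r \<and> f v = 0")
  case True
  define g where "g = f(v := r + 2)"
  have parent: "\<exists>y. (y, x) \<in> E \<and> 0 < g y \<and> g x = Suc (g y)"
    if x: "0 < g x" "x \<noteq> s" for x
  proof (cases "x = v")
    case True
    then show ?thesis
      using uv \<open>f u = Suc r \<and> f v = 0\<close> by (intro exI[of _ u]) (auto simp: g_def)
  next
    case False
    then have "0 < f x" using x by (simp add: g_def)
    then obtain y where "(y, x) \<in> E" "0 < f y" "f x = Suc (f y)"
      using f x unfolding layering_upto_def by metis
    then show ?thesis
      using True False by (intro exI[of _ y]) (auto simp: g_def)
  qed
  have "f s = 1" and bound: "\<And>x. f x \<le> r + 2"
    and arc: "\<And>x y. (x, y) \<in> E \<Longrightarrow> 0 < f x \<Longrightarrow> f x \<le> r \<Longrightarrow> 0 < f y \<and> f y \<le> Suc (f x)"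
    and reached: "\<And>x y. (x, y) \<in> D \<Longrightarrow> f x = Suc r \<Longrightarrow> 0 < f y"
    using f by (auto simp: layering_upto_def)
  have "0 < g y \<and> g y \<le> Suc (g x)"
    if "(x, y) \<in> E" "0 < g x" "g x \<le> r" for x y
    using arc[of x y] that True by (auto simp: g_def split: if_splits)
  moreover have "g s = 1" "\<And>x. g x \<le> r + 2"
    using True \<open>f s = 1\<close> bound by (auto simp: g_def)
  moreover have "0 < g y" if "(x, y) \<in> insert (u, v) D" "g x = Suc r" for x y
    using that reached[of x y] by (auto simp: g_def split: if_splits)
  ultimately have "layering_upto E r (insert (u, v) D) s g"
    unfolding layering_upto_def using parent by blast
  then show ?thesis
    using True by (simp add: g_def)
next
  case False
  with f show ?thesis
    unfolding layering_upto_def by auto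
qed

text \<open>Layers have no gaps: following parents from \<open>v\<close> attains every value from
  \<open>f v\<close> down to 1 on \<open>V\<close>.\<close>

lemma layering_upto_le_card:
  assumes f: "layering_upto E r D s f" and "finite V" "s \<in> V" "E \<subseteq> V \<times> V"
  shows "f v \<le> card V"
proof -
  have "{0<..f v} \<subseteq> f ` V"
  proof (induction "f v" arbitrary: v rule: less_induct)
    case less
    show ?case
    proof (cases "f v = 0 \<or> v = s")
      case True
      then show ?thesis
        using f \<open>s \<in> V\<close> by (auto simp: layering_upto_def intro!: image_eqI[of _ _ s])
    next
      case False
      then obtain u where u: "(u, v) \<in> E" "f v = Suc (f u)"
        using f unfolding layering_upto_def by blast
      then have "{0<..f u} \<subseteq> f ` V"
        by (intro less) simp
      moreover have "{0<..f v} = insert (f v) {0<..f u}"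
        using u by auto
      moreover have "f v \<in> f ` V"
        using u assms(4) by blast
      ultimately show ?thesis by simp
    qed
  qed
  then have "card {0<..f v} \<le> card V"
    using \<open>finite V\<close> by (meson surj_card_le)
  then show ?thesis by simp
qed

text \<open>No layer exceeds \<open>card V\<close>, so after that many rounds the restriction
  \<open>f u \<le> r\<close> is void.\<close>

lemma layering_upto_card:
  assumes f: "layering_upto E (card V) {} s f" and V: "finite V" "s \<in> V" "E \<subseteq> V \<times> V"
  shows "bfs_layering E s f"
  using f layering_upto_le_card[OF f V] unfolding layering_upto_def bfs_layering_def by blast

text \<open>The machine has no parity test, so the class is stored as a bit that flips from parent
  to child. The root, in layer 1, has side 0, the initial content of the array.\<close>

definition sides :: "('a \<Rightarrow> nat) \<Rightarrow> ('a \<Rightarrow> nat) \<Rightarrow> bool" where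
  "sides f g \<longleftrightarrow> (\<forall>v. 0 < f v \<longrightarrow> g v = (if odd (f v) then 0 else 1))"

definition layer_arc :: com where
  "layer_arc = Cond
     (Conj (Equal (Read ''layer'' arc_tail) (Add (var ''round'') (Const 1)))
       (Equal (Read ''layer'' arc_head) (Const 0)))
     (Seq (Assign ''layer'' arc_head (Add (var ''round'') (Const 2)))
       (Assign ''side'' arc_head (Sub (Const 1) (Read ''side'' arc_tail))))
     Skip"

text \<open>Here \<open>for_vertices\<close> merely counts \<open>n\<close> passes over the arc
  list.\<close>

definition layering_program :: com where
  "layering_program = Seq (Assign ''layer'' (Read ''input'' (Const 2)) (Const 1))
     (for_vertices ''round'' (for_arcs layer_arc))"

text \<open>The clause on \<open>done\<close> is carried along for the placement phase, which starts
  with no vertex marked.\<close>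

definition layered :: "nat \<Rightarrow> nat \<Rightarrow> (nat \<times> nat) list \<Rightarrow> nat \<Rightarrow> nat rel \<Rightarrow> memory \<Rightarrow> bool" where
  "layered n s es r D m \<longleftrightarrow> stores_graph n s es m \<and>
     layering_upto (set es) r D s (m ''layer'') \<and> sides (m ''layer'') (m ''side'') \<and>
     m ''done'' = (\<lambda>_. 0)"

lemma halts_layer_arc:
  assumes m: "layered n s es r D m" and "m ''round'' 0 = r"
    and uv: "(u, v) \<in> set es" "aval arc_tail m = u" "aval arc_head m = v"
  shows "halts layer_arc m (ccost layer_arc)
    (\<lambda>m'. layered n s es r (insert (u, v) D) m' \<and> m' ''round'' = m ''round'' \<and>
      m' ''arc'' = m ''arc'')"
proof (rule halts_loop_free)
  show "loop_free layer_arc"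
    by (simp add: layer_arc_def)
  let ?f = "m ''layer''" and ?g = "m ''side''"
  have f: "layering_upto (set es) r (insert (u, v) D) s
      (if ?f u = Suc r \<and> ?f v = 0 then ?f(v := r + 2) else ?f)"
    using m uv(1) by (intro layering_upto_arc) (simp_all add: layered_def)
  show "layered n s es r (insert (u, v) D) (result layer_arc m) \<and>
      result layer_arc m ''round'' = m ''round'' \<and> result layer_arc m ''arc'' = m ''arc''"
  proof (cases "?f u = Suc r \<and> ?f v = 0")
    case True
    then have "?g u = (if odd (Suc r) then 0 else 1)"
      using m by (auto simp: layered_def sides_def)
    then have "sides (?f(v := r + 2)) (?g(v := 1 - ?g u))"
      using m by (auto simp: layered_def sides_def)
    then show ?thesis
      using True f m assms(2) uv(2,3)
      by (simp add: layered_def stores_graph_def layer_arc_def)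
  next
    case False
    then have "result layer_arc m = m"
      using assms(2) uv(2,3) by (auto simp: layer_arc_def)
    then show ?thesis
      using f[unfolded if_not_P[OF False]] m by (simp add: layered_def)
  qed
qed

lemma halts_layering_program:
  assumes "s < n" "Suc n \<le> K" "Suc (length es) \<le> K"
  shows "halts layering_program (input_memory (encoding n s es))
    (1 + 4 + K * (K * (ccost layer_arc + 17) + 17)) (layered n s es n {})"
proof -
  let ?m = "input_memory (encoding n s es)"
  let ?init = "Assign ''layer'' (Read ''input'' (Const 2)) (Const 1)"
  have round: "halts (for_arcs layer_arc) m (K * (ccost layer_arc + 17))
      (\<lambda>m'. layered n s es r (set es) m' \<and> m' ''round'' = m ''round'')"
    if m: "layered n s es r {} m" "m ''round'' 0 = r" for m r
  proof -
    have "halts (for_arcs layer_arc) m (K * (ccost layer_arc + 17))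
      (\<lambda>m'. layered n s es r (set (take (length es) es)) m' \<and> m' ''round'' = m ''round'')"
    proof (rule halts_for_arcs[where n = n and s = s and es = es])
      fix j m'
      assume j: "j < length es"
        and m': "layered n s es r (set (take j es)) m' \<and> m' ''round'' = m ''round''"
        and arc: "aval arc_tail m' = fst (es ! j)" "aval arc_head m' = snd (es ! j)"
      have take: "set (take (Suc j) es) = insert (fst (es ! j), snd (es ! j)) (set (take j es))"
        using j by (simp add: take_Suc_conv_app_nth)
      show "halts layer_arc m' (ccost layer_arc) (\<lambda>m''. (layered n s es r (set (take (Suc j) es)) m'' \<and>
          m'' ''round'' = m ''round'') \<and> m'' ''arc'' = m' ''arc'')"
        using j m' m(2) arc unfolding take
        by (intro halts_mono[OF halts_layer_arc[where D = "set (take j es)" and r = r and m = m']]) auto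
    qed (use m assms in \<open>simp_all add: layered_def stores_graph_def\<close>)
    then show ?thesis by simp
  qed
  have "halts (for_vertices ''round'' (for_arcs layer_arc)) (result ?init ?m)
      (K * (K * (ccost layer_arc + 17) + 17)) (layered n s es n {})"
  proof (rule halts_for_vertices[where n = n and s = s and es = es and I = "\<lambda>r. layered n s es r {}"])
    have "stores_graph n s es ?m"
      by (simp add: stores_graph_def)
    from stores_graph_reads(3)[OF this]
    have "result ?init ?m ''layer'' = (\<lambda>_. 0)(s := 1)"
      by (auto simp: input_memory_def fun_eq_iff)
    then show "layered n s es 0 {} (result ?init ?m)"
      using layering_upto_start[of "set es" s]
      by (simp add: layered_def sides_def stores_graph_def) (simp add: input_memory_def fun_eq_iff)
    show "halts (for_arcs layer_arc) m (K * (ccost layer_arc + 17))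
        (\<lambda>m'. layered n s es (Suc r) {} m' \<and> m' ''round'' = m ''round'')"
      if "layered n s es r {} m" "m ''round'' 0 = r" for r m
      by (rule halts_mono[OF round[OF that]]) (auto simp: layered_def intro: layering_upto_next)
  qed (use assms in \<open>simp_all add: layered_def stores_graph_def\<close>)
  from halts_loop_free_Seq[OF _ this] show ?thesis
    by (simp add: layering_program_def eval_nat_numeral)
qed

section \<open>Computing the order\<close>

definition unchanged :: "string set \<Rightarrow> memory \<Rightarrow> memory \<Rightarrow> bool" where
  "unchanged X m m' \<longleftrightarrow> (\<forall>a. a \<notin> X \<longrightarrow> m' a = m a)"

definition check_arc :: com where
  "check_arc = Cond
     (Conj (Equal arc_head (var ''vertex''))
       (Conj (Equal (Read ''side'' arc_tail) (Read ''side'' arc_head))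
         (Equal (Read ''done'' arc_tail) (Const 0))))
     (set_var ''free'' (Const 0))
     Skip"

text \<open>A later candidate overwrites an earlier one; any available vertex will do.\<close>

definition select_vertex :: com where
  "select_vertex = Cond
     (Conj (Equal (var ''free'') (Const 1)) (Equal (Read ''done'' (var ''vertex'')) (Const 0)))
     (set_var ''pick'' (var ''vertex''))
     Skip"

definition check_vertex :: com where
  "check_vertex = Seq (set_var ''free'' (Const 1)) (Seq (for_arcs check_arc) select_vertex)"

text \<open>Both classes are enumerated in topological order, the first from the left end of the output
  and the second from its right end.\<close>

definition place_vertex :: com where
  "place_vertex = Seq (Assign ''done'' (var ''pick'') (Const 1))
     (Cond (Equal (Read ''side'' (var ''pick'')) (Const 0))
       (Seq (Assign ''output'' (var ''lo'') (var ''pick''))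
         (set_var ''lo'' (Add (var ''lo'') (Const 1))))
       (Seq (Assign ''output'' (var ''hi'') (var ''pick''))
         (set_var ''hi'' (Sub (var ''hi'') (Const 1)))))"

definition init_output :: com where
  "init_output = Seq (set_var ''output'' (Read ''input'' (Const 1)))
     (Seq (set_var ''lo'' (Const 1)) (set_var ''hi'' (Read ''input'' (Const 1))))"

definition placement_program :: com where
  "placement_program = Seq init_output
     (for_vertices ''round'' (Seq (for_vertices ''vertex'' check_vertex) place_vertex))"

text \<open>Phrased with the arrays that \<open>check_arc\<close> reads, \<open>g\<close> for
  \<open>side\<close> and \<open>d\<close> for \<open>done\<close>. For reached vertices, equal
  sides mean layers of equal parity.\<close>

definition blocked :: "('a \<times> 'a) list \<Rightarrow> ('a \<Rightarrow> nat) \<Rightarrow> ('a \<Rightarrow> nat) \<Rightarrow> 'a \<Rightarrow> bool" where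
  "blocked es g d v \<longleftrightarrow> (\<exists>u. (u, v) \<in> set es \<and> g u = g v \<and> d u = 0)"

definition available :: "('a \<times> 'a) list \<Rightarrow> ('a \<Rightarrow> nat) \<Rightarrow> ('a \<Rightarrow> nat) \<Rightarrow> 'a \<Rightarrow> bool" where
  "available es g d v \<longleftrightarrow> d v = 0 \<and> \<not> blocked es g d v"

abbreviation check_cost :: "nat \<Rightarrow> nat" where
  "check_cost K \<equiv> 1 + 3 + (1 + K * (ccost check_arc + 17) + ccost select_vertex)"

lemma halts_check_vertex:
  assumes m: "stores_graph n s es m" "m ''vertex'' 0 = v" and K: "Suc (length es) \<le> K"
  shows "halts check_vertex m (check_cost K) (\<lambda>m'. unchanged {''arc'', ''free'', ''pick''} m m' \<and>
    m' ''pick'' 0 = (if available es (m ''side'') (m ''done'') v then v else m ''pick'' 0))"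
proof -
  let ?g = "m ''side''" and ?d = "m ''done''"
  define I where "I j m' \<longleftrightarrow> unchanged {''arc'', ''free''} m m' \<and>
    m' ''free'' 0 = (if blocked (take j es) ?g ?d v then 0 else 1)" for j m'
  have arcs: "halts (for_arcs check_arc) (result (set_var ''free'' (Const 1)) m)
      (K * (ccost check_arc + 17)) (I (length es))"
  proof (rule halts_for_arcs[where n = n and s = s and es = es])
    show "I 0 (result (set_var ''free'' (Const 1)) m)"
      by (simp add: I_def unchanged_def blocked_def)
    show "stores_graph n s es m'" if "I j m'" for j m'
      using that m(1) by (simp add: I_def unchanged_def stores_graph_def)
    show "I j (m'(''arc'' := x))" if "I j m'" for j m' x
      using that by (simp add: I_def unchanged_def)
    fix j m'
    assume j: "j < length es" and I: "I j m'"
      and arc: "aval arc_tail m' = fst (es ! j)" "aval arc_head m' = snd (es ! j)"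
    obtain u w where uw: "es ! j = (u, w)" by fastforce
    have blocked: "blocked (take (Suc j) es) ?g ?d v \<longleftrightarrow>
        blocked (take j es) ?g ?d v \<or> w = v \<and> ?g u = ?g w \<and> ?d u = 0"
      using j uw by (auto simp: blocked_def take_Suc_conv_app_nth)
    have m': "m' ''vertex'' = m ''vertex''" "m' ''side'' = ?g" "m' ''done'' = ?d"
      using I by (simp_all add: I_def unchanged_def)
    show "halts check_arc m' (ccost check_arc) (\<lambda>m''. I (Suc j) m'' \<and> m'' ''arc'' = m' ''arc'')"
    proof (rule halts_loop_free)
      show "loop_free check_arc" by (simp add: check_arc_def)
      show "I (Suc j) (result check_arc m') \<and> result check_arc m' ''arc'' = m' ''arc''"
        using I arc uw m' m(2) unfolding I_def blocked
        by (simp add: check_arc_def unchanged_def)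
    qed
  qed (rule K)
  have select: "halts select_vertex m' (ccost select_vertex)
      (\<lambda>m'. unchanged {''arc'', ''free'', ''pick''} m m' \<and>
        m' ''pick'' 0 = (if available es ?g ?d v then v else m ''pick'' 0))"
    if "I (length es) m'" for m'
  proof (rule halts_loop_free)
    show "loop_free select_vertex" by (simp add: select_vertex_def)
    have m': "m' ''vertex'' = m ''vertex''" "m' ''done'' = ?d" "m' ''pick'' = m ''pick''"
      using that by (simp_all add: I_def unchanged_def)
    show "unchanged {''arc'', ''free'', ''pick''} m (result select_vertex m') \<and>
        result select_vertex m' ''pick'' 0 = (if available es ?g ?d v then v else m ''pick'' 0)"
      using that m' m(2) unfolding I_def
      by (simp add: select_vertex_def unchanged_def available_def)
  qed
  have "halts (Seq (for_arcs check_arc) select_vertex) (result (set_var ''free'' (Const 1)) m)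
      (1 + K * (ccost check_arc + 17) + ccost select_vertex)
      (\<lambda>m'. unchanged {''arc'', ''free'', ''pick''} m m' \<and>
        m' ''pick'' 0 = (if available es ?g ?d v then v else m ''pick'' 0))"
    by (rule halts_SeqI[OF arcs select])
  from halts_loop_free_Seq[OF _ this] show ?thesis
    by (simp add: check_vertex_def eval_nat_numeral)
qed

text \<open>The claim about \<open>pick\<close> is conditional, since the array may hold a stale
  value; well-foundedness supplies an available vertex later.\<close>

lemma halts_find_vertex:
  assumes m: "stores_graph n s es m" and K: "Suc n \<le> K" "Suc (length es) \<le> K"
  shows "halts (for_vertices ''vertex'' check_vertex) m (K * (check_cost K + 17))
    (\<lambda>m'. unchanged {''arc'', ''free'', ''pick'', ''vertex''} m m' \<and>
      ((\<exists>v < n. available es (m ''side'') (m ''done'') v) \<longrightarrow>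
        m' ''pick'' 0 < n \<and> available es (m ''side'') (m ''done'') (m' ''pick'' 0)))"
proof -
  let ?g = "m ''side''" and ?d = "m ''done''"
  define I where "I j m' \<longleftrightarrow> unchanged {''arc'', ''free'', ''pick'', ''vertex''} m m' \<and>
      ((\<exists>v < j. available es ?g ?d v) \<longrightarrow>
        m' ''pick'' 0 < n \<and> available es ?g ?d (m' ''pick'' 0))" for j m'
  have "halts (for_vertices ''vertex'' check_vertex) m (K * (check_cost K + 17)) (I n)"
  proof (rule halts_for_vertices[where n = n and s = s and es = es])
    show "I 0 m"
      by (simp add: I_def unchanged_def)
    show stores: "stores_graph n s es m'" if "I j m'" for j m'
      using that m by (simp add: I_def unchanged_def stores_graph_def)
    show "I j (m'(''vertex'' := x))" if "I j m'" for j m' x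
      using that by (simp add: I_def unchanged_def)
    fix j m'
    assume j: "j < n" and I: "I j m'" and v: "m' ''vertex'' 0 = j"
    have m': "m' ''side'' = ?g" "m' ''done'' = ?d"
      using I by (simp_all add: I_def unchanged_def)
    show "halts check_vertex m' (check_cost K) (\<lambda>m''. I (Suc j) m'' \<and> m'' ''vertex'' = m' ''vertex'')"
    proof (rule halts_mono[OF halts_check_vertex[OF stores[OF I] v K(2)]])
      fix m''
      assume m'': "unchanged {''arc'', ''free'', ''pick''} m' m'' \<and> m'' ''pick'' 0 =
        (if available es (m' ''side'') (m' ''done'') j then j else m' ''pick'' 0)"
      then show "I (Suc j) m'' \<and> m'' ''vertex'' = m' ''vertex''"
        using I j unfolding I_def m' by (auto simp: unchanged_def less_Suc_eq)
    qed simp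
  qed (rule K)
  then show ?thesis
    unfolding I_def .
qed

section \<open>The output array during placement\<close>

definition holds_output :: "nat \<Rightarrow> (nat \<Rightarrow> bool) \<Rightarrow> nat list \<Rightarrow> memory \<Rightarrow> bool" where
  "holds_output n P xs m \<longleftrightarrow> (let as = filter P xs; bs = filter (\<lambda>v. \<not> P v) xs in
     m ''output'' 0 = n \<and> m ''lo'' 0 = Suc (length as) \<and> m ''hi'' 0 = n - length bs \<and>
     (\<forall>i < length as. m ''output'' (Suc i) = as ! i) \<and>
     (\<forall>i < length bs. m ''output'' (n - i) = bs ! i))"

definition placed ::
  "nat \<Rightarrow> nat \<Rightarrow> (nat \<times> nat) list \<Rightarrow> (nat \<Rightarrow> nat) \<Rightarrow> nat list \<Rightarrow> memory \<Rightarrow> bool" where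
  "placed n s es f xs m \<longleftrightarrow> stores_graph n s es m \<and> sides f (m ''side'') \<and>
     m ''done'' = (\<lambda>v. if v \<in> set xs then 1 else 0) \<and> set xs \<subseteq> {..<n} \<and>
     topological (same_parity_arcs (set es) f) xs \<and> holds_output n (\<lambda>v. odd (f v)) xs m"

text \<open>When \<open>n\<close> vertices are placed, the two parts meet without a gap. The second
  was written from cell \<open>n\<close> downwards, so it is read in reverse.\<close>

lemma output_list_eq_lr_list:
  assumes "holds_output n P xs m" "length xs = n"
  shows "output_list m = lr_list P xs"
proof -
  define as bs where "as = filter P xs" and "bs = filter (\<lambda>v. \<not> P v) xs"
  have len: "length as + length bs = n"
    using assms(2) sum_length_filter_compl[of P xs] by (simp add: as_def bs_def)
  have m: "m ''output'' 0 = n" "\<And>i. i < length as \<Longrightarrow> m ''output'' (Suc i) = as ! i"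
    "\<And>i. i < length bs \<Longrightarrow> m ''output'' (n - i) = bs ! i"
    using assms(1) by (auto simp: holds_output_def Let_def as_def bs_def)
  have "output_list m = as @ rev bs"
  proof (rule nth_equalityI)
    show "length (output_list m) = length (as @ rev bs)"
      using len m(1) by (simp add: output_list_def)
    fix i
    assume "i < length (output_list m)"
    then have i: "i < n" by (simp add: output_list_def m(1))
    then have out: "output_list m ! i = m ''output'' (Suc i)"
      by (simp add: output_list_def m(1))
    show "output_list m ! i = (as @ rev bs) ! i"
    proof (cases "i < length as")
      case True
      then show ?thesis by (simp add: out m(2) nth_append)
    next
      case False
      then have "length bs - Suc (i - length as) = n - Suc i"
        using i len by linarith
      then have "(as @ rev bs) ! i = bs ! (n - Suc i)"
        using False i len by (simp add: nth_append rev_nth)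
      moreover have "m ''output'' (n - (n - Suc i)) = bs ! (n - Suc i)"
        using False i len by (intro m(3)) auto
      ultimately show ?thesis
        using i by (simp add: out Suc_leI)
    qed
  qed
  then show ?thesis by (simp add: lr_list_def as_def bs_def)
qed

lemma placed_place_vertex:
  assumes m: "placed n s es f xs m" and es: "set es \<subseteq> {..<n} \<times> {..<n}"
    and pos: "\<And>v. v < n \<Longrightarrow> 0 < f v"
    and v: "m ''pick'' 0 = v" "v < n" "available es (m ''side'') (m ''done'') v"
  shows "placed n s es f (xs @ [v]) (result place_vertex m)"
proof -
  define P where "P = (\<lambda>v. odd (f v))"
  define as bs where "as = filter P xs" and "bs = filter (\<lambda>v. \<not> P v) xs"
  have g: "m ''side'' u = (if P u then 0 else 1)" if "u < n" for u
    using m pos[OF that] by (simp add: placed_def sides_def P_def)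
  have d: "m ''done'' = (\<lambda>v. if v \<in> set xs then 1 else 0)"
    using m by (simp add: placed_def)
  have xs: "distinct xs" "set xs \<subseteq> {..<n}"
    using m by (simp_all add: placed_def topological_def)
  have notin: "v \<notin> set xs"
    using v(3) d by (auto simp: available_def)
  have top: "topological (same_parity_arcs (set es) f) (xs @ [v])"
  proof (rule topological_snoc)
    show "topological (same_parity_arcs (set es) f) xs"
      using m by (simp add: placed_def)
    fix u
    assume "(u, v) \<in> same_parity_arcs (set es) f"
    then have "(u, v) \<in> set es" "P u \<longleftrightarrow> P v"
      by (auto simp: same_parity_arcs_def P_def)
    moreover from this have "m ''side'' u = m ''side'' v"
      using es g by auto
    ultimately show "u \<in> set xs"
      using v(3) d by (auto simp: available_def blocked_def split: if_splits)
  qed (rule notin)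
  have "card (insert v (set xs)) \<le> card {..<n}"
    using xs v(2) by (intro card_mono) auto
  then have "length xs < n"
    using notin xs(1) by (simp add: distinct_card)
  \<comment> \<open>Strictness leaves a free cell: a write at one end cannot hit the other part, and
    \<open>hi\<close> is still positive, so the length in cell 0 survives.\<close>
  then have len: "length as + length bs < n"
    using sum_length_filter_compl[of P xs] by (simp add: as_def bs_def)
  have out: "m ''output'' 0 = n" "m ''lo'' 0 = Suc (length as)" "m ''hi'' 0 = n - length bs"
    "\<And>i. i < length as \<Longrightarrow> m ''output'' (Suc i) = as ! i"
    "\<And>i. i < length bs \<Longrightarrow> m ''output'' (n - i) = bs ! i"
    using m unfolding placed_def holds_output_def P_def[symmetric] Let_def as_def bs_def
    by simp_all
  have "holds_output n P (xs @ [v]) (result place_vertex m)"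
  proof (cases "P v")
    case True
    have "n - i \<noteq> Suc (length as)" if "i < length bs" for i
      using that len by linarith
    then show ?thesis
      using True out g[OF v(2)] v(1)
      by (simp add: holds_output_def Let_def place_vertex_def as_def[symmetric] bs_def[symmetric]
          nth_append less_Suc_eq)
  next
    case False
    have "Suc i \<noteq> n - length bs" if "i < length as" for i
      using that len by linarith
    moreover have "n - i \<noteq> n - length bs" if "i < length bs" for i
      using that len by linarith
    ultimately show ?thesis
      using False out g[OF v(2)] v(1) len
      by (simp add: holds_output_def Let_def place_vertex_def as_def[symmetric] bs_def[symmetric]
          nth_append less_Suc_eq)
  qed
  moreover have "result place_vertex m ''input'' = m ''input''"
    "result place_vertex m ''side'' = m ''side''"
    "result place_vertex m ''done'' = (\<lambda>u. if u \<in> set (xs @ [v]) then 1 else 0)"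
    using v(1) d by (simp_all add: place_vertex_def fun_eq_iff)
  ultimately show ?thesis
    using m top v(2) d unfolding placed_def P_def[symmetric]
    by (simp add: stores_graph_def)
qed

abbreviation placement_cost :: "nat \<Rightarrow> nat" where
  "placement_cost K \<equiv>
     1 + ccost init_output + K * ((1 + K * (check_cost K + 17) + ccost place_vertex) + 17)"

lemma halts_placement_program:
  assumes m: "stores_graph n s es m" "sides f (m ''side'')" "m ''done'' = (\<lambda>_. 0)"
    and es: "set es \<subseteq> {..<n} \<times> {..<n}" and pos: "\<And>v. v < n \<Longrightarrow> 0 < f v"
    and wf: "wf (same_parity_arcs (set es) f)"
    and K: "Suc n \<le> K" "Suc (length es) \<le> K"
  shows "halts placement_program m (placement_cost K)
    (\<lambda>m'. \<exists>xs. length xs = n \<and> placed n s es f xs m')"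
proof -
  have round: "halts (Seq (for_vertices ''vertex'' check_vertex) place_vertex) m
      (1 + K * (check_cost K + 17) + ccost place_vertex)
      (\<lambda>m'. (\<exists>xs. length xs = Suc r \<and> placed n s es f xs m') \<and> m' ''round'' = m ''round'')"
    if "r < n" and xs: "length xs = r" "placed n s es f xs m" for r m xs
  proof (rule halts_SeqI)
    show "halts (for_vertices ''vertex'' check_vertex) m (K * (check_cost K + 17))
      (\<lambda>m'. unchanged {''arc'', ''free'', ''pick'', ''vertex''} m m' \<and>
        ((\<exists>v < n. available es (m ''side'') (m ''done'') v) \<longrightarrow>
          m' ''pick'' 0 < n \<and> available es (m ''side'') (m ''done'') (m' ''pick'' 0)))"
      using xs K by (intro halts_find_vertex) (auto simp: placed_def)
    fix m'
    assume m': "unchanged {''arc'', ''free'', ''pick'', ''vertex''} m m' \<and>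
        ((\<exists>v < n. available es (m ''side'') (m ''done'') v) \<longrightarrow>
          m' ''pick'' 0 < n \<and> available es (m ''side'') (m ''done'') (m' ''pick'' 0))"
    have eq: "m' a = m a" if "a \<notin> {''arc'', ''free'', ''pick'', ''vertex''}" for a
      using m' that by (simp add: unchanged_def)
    \<comment> \<open>Fewer than \<open>n\<close> vertices are placed before this round, so
      well-foundedness provides one that the scan must recognise as available.\<close>
    have "\<not> {..<n} \<subseteq> set xs"
      using card_mono[of "set xs" "{..<n}"] card_length[of xs] xs(1) \<open>r < n\<close> by auto
    moreover have "same_parity_arcs (set es) f \<subseteq> {..<n} \<times> {..<n}"
      using es by (auto simp: same_parity_arcs_def)
    ultimately obtain v where v: "v \<in> {..<n} - set xs"
      "\<And>u. (u, v) \<in> same_parity_arcs (set es) f \<Longrightarrow> u \<in> set xs"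
      using topological_extendable[OF wf] by metis
    have "available es (m ''side'') (m ''done'') v"
    proof -
      have "u \<in> set xs" if uv: "(u, v) \<in> set es" and side: "m ''side'' u = m ''side'' v" for u
      proof (rule v(2))
        have "0 < f u" "0 < f v"
          using uv es pos by auto
        moreover have "sides f (m ''side'')"
          using xs(2) by (simp add: placed_def)
        ultimately have "m ''side'' u = (if odd (f u) then 0 else 1)"
          "m ''side'' v = (if odd (f v) then 0 else 1)"
          unfolding sides_def by blast+
        then have "even (f u) \<longleftrightarrow> even (f v)"
          using side by (metis zero_neq_one)
        then show "(u, v) \<in> same_parity_arcs (set es) f"
          using uv by (simp add: same_parity_arcs_def)
      qed
      then show ?thesis
        using v(1) xs(2) by (auto simp: available_def blocked_def placed_def)
    qed
    then have pick: "m' ''pick'' 0 < n" "available es (m' ''side'') (m' ''done'') (m' ''pick'' 0)"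
      using m' v(1) by (auto simp: eq)
    have "placed n s es f xs m'"
      using xs(2) by (simp add: placed_def stores_graph_def holds_output_def Let_def eq)
    from placed_place_vertex[OF this es pos refl pick]
    have "placed n s es f (xs @ [m' ''pick'' 0]) (result place_vertex m')" .
    moreover have "result place_vertex m' ''round'' = m ''round''"
      by (simp add: place_vertex_def eq)
    ultimately show "halts place_vertex m' (ccost place_vertex)
        (\<lambda>m'. (\<exists>xs. length xs = Suc r \<and> placed n s es f xs m') \<and> m' ''round'' = m ''round'')"
      using xs(1) by (intro halts_loop_free conjI exI[of _ "xs @ [m' ''pick'' 0]"])
        (simp add: place_vertex_def, simp_all)
  qed
  have "halts (for_vertices ''round'' (Seq (for_vertices ''vertex'' check_vertex) place_vertex))
      (result init_output m) (K * ((1 + K * (check_cost K + 17) + ccost place_vertex) + 17))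
      (\<lambda>m'. \<exists>xs. length xs = n \<and> placed n s es f xs m')"
  proof (rule halts_for_vertices[where n = n and s = s and es = es
        and I = "\<lambda>r m'. \<exists>xs. length xs = r \<and> placed n s es f xs m'"])
    have "topological (same_parity_arcs (set es) f) []"
      by (simp add: topological_def)
    then have "placed n s es f [] (result init_output m)"
      using m stores_graph_reads(2)[OF m(1)]
      by (simp add: placed_def init_output_def holds_output_def stores_graph_def)
    then show "\<exists>xs. length xs = 0 \<and> placed n s es f xs (result init_output m)"
      by simp
    show "stores_graph n s es m'" if "\<exists>xs. length xs = r \<and> placed n s es f xs m'" for r m'
      using that by (auto simp: placed_def)
    show "\<exists>xs. length xs = r \<and> placed n s es f xs (m'(''round'' := x))"
      if "\<exists>xs. length xs = r \<and> placed n s es f xs m'" for r m' x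
      using that by (simp add: placed_def stores_graph_def holds_output_def Let_def)
  qed (use round K in blast)+
  then show ?thesis
    unfolding placement_program_def
    by (intro halts_loop_free_Seq) (simp add: init_output_def)
qed

section \<open>Input size and correctness of the whole program\<close>

text \<open>The number \<open>n\<close> is given in binary and could be exponential in its bit
  length. Reachability from \<open>s\<close> gives every other vertex an incoming arc, so
  \<open>n\<close> is bounded by the length of the arc list.\<close>

lemma (in pair_digraph) card_verts_le_Suc_card_arcs:
  assumes "flow_graph G s"
  shows "card (pverts G) \<le> Suc (card (parcs G))"
proof -
  have "v \<in> snd ` parcs G" if "v \<in> pverts G" "v \<noteq> s" for v
    using flow_graph_reachable[OF assms that(1)] that(2)
    by (cases rule: rtranclE) force+
  then have "pverts G \<subseteq> insert s (snd ` parcs G)"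
    by blast
  then have "card (pverts G) \<le> card (insert s (snd ` parcs G))"
    using pair_finite_arcs by (intro card_mono) simp_all
  also have "\<dots> \<le> Suc (card (snd ` parcs G))"
    by (rule card_insert_le_m1) simp_all
  also have "\<dots> \<le> Suc (card (parcs G))"
    using pair_finite_arcs by (simp add: card_image_le)
  finally show ?thesis .
qed

lemma length_le_input_size: "length xs \<le> input_size xs"
  by (induction xs) (simp_all add: input_size_def)

definition lr_program :: com where
  "lr_program = Seq layering_program placement_program"

abbreviation lr_cost :: "nat \<Rightarrow> nat" where
  "lr_cost K \<equiv> 1 + (1 + 4 + K * (K * (ccost layer_arc + 17) + 17)) + placement_cost K"

lemma lr_program_correct:
  fixes G :: "nat pair_pre_digraph"
  assumes "pair_digraph G" and red: "reducible_flow_graph G s"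
    and code: "encodes_rooted_graph (G, s) xs"
  shows "halts lr_program (input_memory xs) (lr_cost (input_size xs))
    (\<lambda>m. lists_lr_order (G, s) (output_list m))"
proof -
  interpret pair_digraph G by fact
  obtain n es where V: "pverts G = {..<n}" and es: "distinct es" "set es = parcs G"
    and xs: "xs = encoding n s es"
    using code by (auto simp: encodes_rooted_graph_def encoding_def)
  have flow: "flow_graph G s"
    using red by (simp add: reducible_flow_graph_def)
  have arcs: "set es \<subseteq> {..<n} \<times> {..<n}"
    using es(2) V by (force dest: in_arcsD1 in_arcsD2)
  have s: "s < n"
    using flow V by (simp add: flow_graph_def)
  define K where "K = input_size xs"
  have "2 + 2 * length es \<le> K"
    using length_le_input_size[of xs] by (simp add: K_def xs length_encoding)
  moreover have "n \<le> Suc (length es)"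
    using card_verts_le_Suc_card_arcs[OF flow] distinct_card[OF es(1)] es(2) V by simp
  ultimately have K: "Suc n \<le> K" "Suc (length es) \<le> K" by simp_all
  have "halts lr_program (input_memory xs) (lr_cost K)
    (\<lambda>m. \<exists>f ys. length ys = n \<and> placed n s es f ys m)"
    unfolding lr_program_def xs
  proof (rule halts_SeqI[OF halts_layering_program[OF s K]])
    fix m
    assume m: "layered n s es n {} m"
    then have f: "bfs_layering (parcs G) s (m ''layer'')"
      using layering_upto_card[of "set es" "{..<n}" s "m ''layer''"] s arcs es(2)
      by (simp add: layered_def)
    have "0 < m ''layer'' v" if "v < n" for v
      using that V by (intro bfs_layering_reaches[OF f] flow_graph_reachable[OF flow]) simp
    moreover have "wf (same_parity_arcs (set es) (m ''layer''))"
      using wf_same_parity_arcs[OF red f] es(2) by simp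
    ultimately have "halts placement_program m (placement_cost K)
        (\<lambda>m'. \<exists>ys. length ys = n \<and> placed n s es (m ''layer'') ys m')"
      using m arcs K by (intro halts_placement_program) (simp_all add: layered_def)
    then show "halts placement_program m (placement_cost K)
        (\<lambda>m'. \<exists>f ys. length ys = n \<and> placed n s es f ys m')"
      by (rule halts_mono) auto
  qed
  then show ?thesis
    unfolding K_def
  proof (rule halts_mono)
    fix m
    assume "\<exists>f ys. length ys = n \<and> placed n s es f ys m"
    then obtain f ys where len: "length ys = n" and ys: "placed n s es f ys m"
      by (elim exE conjE)
    have top: "topological (same_parity_arcs (parcs G) f) ys"
      using ys es(2) by (simp add: placed_def)
    then have dist: "distinct ys"
      by (simp add: topological_def)
    \<comment> \<open>The \<open>n\<close> placed vertices are distinct and below \<open>n\<close>,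
      so they are all vertices.\<close>
    have set: "set ys = pverts G"
      using ys len distinct_card[OF dist] V
      by (intro card_subset_eq) (simp_all add: placed_def)
    have "output_list m = lr_list (\<lambda>v. odd (f v)) ys"
      using ys len by (intro output_list_eq_lr_list) (simp_all add: placed_def)
    then show "lists_lr_order (G, s) (output_list m)"
      using lr_order_lr_list[OF top set] dist set by (simp add: lists_lr_order_def)
  qed simp
qed

theorem theorem4:
  shows "solvable_in_poly_time {(G, s). pair_digraph G \<and> reducible_flow_graph G s}
           encodes_rooted_graph lists_lr_order
       \<and> (\<forall>(G :: 'a pair_pre_digraph) s. pair_digraph G \<and> reducible_flow_graph G s
             \<longrightarrow> (\<exists>r. lr_order G r))"
proof (intro conjI allI impI)
  define X :: "nat poly" where "X = [:0, 1:]"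
  define c :: "nat \<Rightarrow> nat poly" where "c k = [:k:]" for k
  \<comment> \<open>This is \<open>lr_cost\<close> with the input size as indeterminate
    \<open>X\<close>; the numbers 6, 18 and 22 collect its additive constants.\<close>
  define p where "p = c 6 + X * (X * c (ccost layer_arc + 17) + c 17) +
    (c (1 + ccost init_output) + X * (c (18 + ccost place_vertex) +
      X * (c (22 + ccost select_vertex) + X * c (ccost check_arc + 17))))"
  have p: "poly p K = lr_cost K" for K
    by (simp add: p_def X_def c_def algebra_simps)
  show "solvable_in_poly_time {(G, s). pair_digraph G \<and> reducible_flow_graph G s}
      encodes_rooted_graph lists_lr_order"
    unfolding solvable_in_poly_time_def
    using lr_program_correct
    by (intro exI[of _ lr_program] exI[of _ p]) (force simp: halts_def p)
  show "\<exists>r. lr_order G r" if "pair_digraph G \<and> reducible_flow_graph G s"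
    for G :: "'a pair_pre_digraph" and s
    using that pair_digraph.lr_order_exists by (elim conjE)
qed

end
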